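(* Let $a\in\mathcal{T}\subset\mathbb{R}^n$ be a point of the tubular neighborhood $\mathcal{T}$ of $\mathcal{I}$, so that $a$ has a unique closest point $x=\mathrm{P}_{\mathcal{I}}(a)\in\mathcal{I}$, let $y\in\mathcal{O}$ be such that $(a,y)\in\mathcal{S}_{\mathrm{AP}}$, and let $\eta=a-x$. Then \[ \kappa[\mathcal{S}_{\mathrm{AP}}](a,y)=\|(\mathrm{D}_{(x,y)}\pi_{\mathcal{O}})(\mathrm{D}_{(x,y)}\pi_{\mathcal{I}})^{-1}H_\eta^{-1}\|_{\mathcal{I}\to\mathcal{O}}, \] where $H_\eta=\mathbf{1}-S_\eta$ and the right-hand side is read as $+\infty$ if one of the inverses does not exist. Moreover, if $(a,y)\in\mathcal{S}_{\mathrm{AP}}\setminus\mathcal{W}_{\mathrm{AP}}$, then $\mathrm{D}_{(x,y)}\pi_{\mathcal{I}}$ is not invertible.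
   Context: Standing assumptions: $\mathcal{I}\subset\mathbb{R}^n$ is an $m$-dimensional embedded smooth submanifold with the Riemannian metric inherited from the Euclidean inner product; $\mathcal{O}$ is a smooth Riemannian manifold; $\mathcal{S}\subset\mathcal{I}\times\mathcal{O}$ is a smoothly embedded $m$-dimensional submanifold with coordinate projections $\pi_{\mathcal{I}}:\mathcal{S}\to\mathcal{I}$ and $\pi_{\mathcal{O}}:\mathcal{S}\to\mathcal{O}$; $\pi_{\mathcal{I}}$ is surjective; and the set $\mathcal{W}=\{(x,y)\in\mathcal{S}\mid \mathrm{D}_{(x,y)}\pi_{\mathcal{I}}\text{ is invertible}\}$ of well-posed tuples is an open dense embedded submanifold of $\mathcal{S}$. $\mathrm{D}_pF$ denotes the derivative of $F$ at $p$. $\mathcal{T}=\{p+\eta\mid p\in\mathcal{I},\ \eta\in\mathrm{N}_p\mathcal{I},\ \|\eta\|<\delta(p)\}$ is an open tubular neighborhood of $\mathcal{I}$ in $\mathbb{R}^n$, where $\mathrm{N}_p\mathcal{I}=(\mathrm{T}_p\mathcal{I})^\perp$ and $\delta:\mathcal{I}\to(0,\infty)$ is continuous and chosen such that $(p,\eta)\mapsto p+\eta$ is a diffeomorphism from $\{(p,\eta)\mid \eta\in\mathrm{N}_p\mathcal{I},\|\eta\|<\delta(p)\}$ onto $\mathcal{T}$ and $p$ is the unique point of $\mathcal{I}$ closest to $p+\eta$. $\mathrm{P}_{\mathcal{I}}:\mathcal{T}\to\mathcal{I}$, $a\mapsto\mathrm{argmin}_{x\in\mathcal{I}}\|x-a\|$.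 $\mathcal{S}_{\mathrm{AP}}=\{(a,y)\in\mathcal{T}\times\mathcal{O}\mid(\mathrm{P}_{\mathcal{I}}(a),y)\in\mathcal{S}\}$ and $\mathcal{W}_{\mathrm{AP}}=\{(a,y)\in\mathcal{T}\times\mathcal{O}\mid(\mathrm{P}_{\mathcal{I}}(a),y)\in\mathcal{W}\}$; the latter is a smooth embedded $n$-dimensional submanifold of $\mathcal{T}\times\mathcal{O}$. With $\Pi_{\mathbb{R}^n}:\mathcal{W}_{\mathrm{AP}}\to\mathbb{R}^n$, $\Pi_{\mathcal{O}}:\mathcal{W}_{\mathrm{AP}}\to\mathcal{O}$ the coordinate projections, the condition number at $(a,y)\in\mathcal{W}_{\mathrm{AP}}$ is $\kappa[\mathcal{S}_{\mathrm{AP}}](a,y)=\|(\mathrm{D}_{(a,y)}\Pi_{\mathcal{O}})(\mathrm{D}_{(a,y)}\Pi_{\mathbb{R}^n})^{-1}\|_{\mathbb{R}^n\to\mathcal{O}}$ (and $+\infty$ if the inverse does not exist); at points of $\mathcal{S}_{\mathrm{AP}}\setminus\mathcal{W}_{\mathrm{AP}}$ it is $+\infty$. Here $\|A\|_{\mathcal{M}\to\mathcal{N}}=\sup_{t\neq0}\|At\|_{\mathcal{N}}/\|t\|_{\mathcal{M}}$ is the spectral norm of a linear map between tangent spaces of Riemannian manifolds $\mathcal{M},\mathcal{N}$. For $\eta\in\mathrm{N}_x\mathcal{I}$, the Weingarten map $S_\eta:\mathrm{T}_x\mathcal{I}\to\mathrm{T}_x\mathcal{I}$ is the self-adjoint map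 with $\langle S_\eta(v),w\rangle=\langle\mathit{I\!I}_x(v,w),\eta\rangle$, where $\mathit{I\!I}_x(v,w)\in\mathrm{N}_x\mathcal{I}$ is the second fundamental form (the normal component of the Euclidean directional derivative along $v$ of a tangent vector field extending $w$), and $H_\eta:=\mathbf{1}-S_\eta$ with $\mathbf{1}$ the identity of $\mathrm{T}_x\mathcal{I}$. *)

theory Defs
  imports "HOL-Analysis.Analysis"
begin

section \<open>Smooth maps between normed spaces\<close>

text \<open>Used for open \<open>X\<close> in a finite-dimensional space, where existence and continuity of all
  iterated directional derivatives is the usual \<open>C\<^sup>k\<close> condition.\<close>

primrec Ck_on :: "nat \<Rightarrow> 'a::real_normed_vector set \<Rightarrow> ('a \<Rightarrow> 'b::real_normed_vector) \<Rightarrow> bool" where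
  "Ck_on 0 X f \<longleftrightarrow> continuous_on X f"
| "Ck_on (Suc k) X f \<longleftrightarrow> (\<forall>x\<in>X. f differentiable (at x)) \<and>
     (\<forall>v. Ck_on k X (\<lambda>x. frechet_derivative f (at x) v))"

definition smooth_on :: "'a::real_normed_vector set \<Rightarrow> ('a \<Rightarrow> 'b::real_normed_vector) \<Rightarrow> bool" where
  "smooth_on X f \<longleftrightarrow> (\<forall>k. Ck_on k X f)"

text \<open>Smoothness on an arbitrary subset by local smooth extension. For embedded submanifolds of
  Euclidean spaces this is smoothness in the sense of manifolds.\<close>

definition subset_smooth :: "'a::real_normed_vector set \<Rightarrow> ('a \<Rightarrow> 'b::real_normed_vector) \<Rightarrow> bool" where
  "subset_smooth X f \<longleftrightarrow> (\<forall>x\<in>X. \<exists>U h. open U \<and> x \<in> U \<and> smooth_on U h \<and> (\<forall>z\<in>X \<inter> U. h z = f z))"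

definition subset_diffeo ::
  "'a::real_normed_vector set \<Rightarrow> 'b::real_normed_vector set \<Rightarrow> ('a \<Rightarrow> 'b) \<Rightarrow> bool" where
  "subset_diffeo X Y f \<longleftrightarrow> bij_betw f X Y \<and> subset_smooth X f \<and> subset_smooth Y (inv_into X f)"


section \<open>Smooth manifolds and embedded submanifolds\<close>

text \<open>A chart is a pair of its domain and its coordinate map. The model space \<open>'e\<close> is
  any finite-dimensional normed space; the class \<open>euclidean_space\<close> would exclude dimension 0.\<close>

type_synonym ('b, 'e) chart = "'b set \<times> ('b \<Rightarrow> 'e)"

record ('b, 'e) manifold =
  mtop :: "'b topology"
  atlas :: "('b, 'e) chart set"

definition chart_inv :: "('b, 'e) chart \<Rightarrow> 'e \<Rightarrow> 'b" where
  "chart_inv c = inv_into (fst c) (snd c)"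

definition is_chart :: "'b topology \<Rightarrow> ('b, 'e::real_normed_vector) chart \<Rightarrow> bool" where
  "is_chart X c \<longleftrightarrow> openin X (fst c) \<and> open (snd c ` fst c) \<and>
     homeomorphic_map (subtopology X (fst c)) (top_of_set (snd c ` fst c)) (snd c)"

definition compatible :: "('b, 'e::real_normed_vector) chart \<Rightarrow> ('b, 'e) chart \<Rightarrow> bool" where
  "compatible c d \<longleftrightarrow>
     smooth_on (snd c ` (fst c \<inter> fst d)) (snd d \<circ> chart_inv c) \<and>
     smooth_on (snd d ` (fst c \<inter> fst d)) (snd c \<circ> chart_inv d)"

definition smooth_manifold :: "('b, 'e::real_normed_vector) manifold \<Rightarrow> bool" where
  "smooth_manifold M \<longleftrightarrow>
     (\<exists>B::'e set. finite B \<and> span B = UNIV) \<and>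
     Hausdorff_space (mtop M) \<and> second_countable (mtop M) \<and>
     (\<Union>c\<in>atlas M. fst c) = topspace (mtop M) \<and>
     (\<forall>c\<in>atlas M. is_chart (mtop M) c) \<and>
     (\<forall>c\<in>atlas M. \<forall>d\<in>atlas M. compatible c d)"

definition euclidean_mfd :: "('a::euclidean_space, 'a) manifold" where
  "euclidean_mfd = \<lparr>mtop = euclidean, atlas = {(UNIV, id)}\<rparr>"

definition prod_mfd ::
  "('b, 'e) manifold \<Rightarrow> ('c, 'f) manifold \<Rightarrow> ('b \<times> 'c, 'e \<times> 'f) manifold" where
  "prod_mfd M N = \<lparr>mtop = prod_topology (mtop M) (mtop N),
     atlas = {(fst c \<times> fst d, map_prod (snd c) (snd d)) | c d. c \<in> atlas M \<and> d \<in> atlas N}\<rparr>"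

text \<open>The local slice condition, for charts of the maximal atlas. If \<open>I\<close> is embedded in \<open>M\<close> and
  \<open>Z \<subseteq> I \<times> N\<close>, then \<open>Z\<close> is embedded in \<open>I \<times> N\<close> iff it is embedded in \<open>M \<times> N\<close>.\<close>

definition embedded_submanifold ::
  "('b, 'e::real_normed_vector) manifold \<Rightarrow> nat \<Rightarrow> 'b set \<Rightarrow> bool" where
  "embedded_submanifold M k Z \<longleftrightarrow> Z \<subseteq> topspace (mtop M) \<and>
     (\<forall>p\<in>Z. \<exists>c V. is_chart (mtop M) c \<and> (\<forall>d\<in>atlas M. compatible c d) \<and> p \<in> fst c \<and>
        subspace V \<and> dim V = k \<and> snd c ` (fst c \<inter> Z) = snd c ` fst c \<inter> V)"


section \<open>Tangent vectors and differentials\<close>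

text \<open>\<open>curves M Z p\<close>: curves that are smooth into \<open>M\<close> near time 0, run inside \<open>Z\<close> and are at \<open>p\<close>
  at time 0. If \<open>Z\<close> is an embedded submanifold, these are the smooth curves in \<open>Z\<close>.\<close>

definition curves :: "('b, 'e::real_normed_vector) manifold \<Rightarrow> 'b set \<Rightarrow> 'b \<Rightarrow> (real \<Rightarrow> 'b) set" where
  "curves M Z p = {\<gamma>. \<gamma> 0 = p \<and> (\<exists>\<epsilon>>0.
     continuous_map (top_of_set {-\<epsilon><..<\<epsilon>}) (mtop M) \<gamma> \<and> \<gamma> ` {-\<epsilon><..<\<epsilon>} \<subseteq> Z \<and>
     (\<forall>c\<in>atlas M. smooth_on {t\<in>{-\<epsilon><..<\<epsilon>}. \<gamma> t \<in> fst c} (snd c \<circ> \<gamma>)))}"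

text \<open>A tangent vector of an abstract manifold is given by its coordinates in all charts of the
  atlas around the base point (and by 0 for the other charts).\<close>

type_synonym ('b, 'e) tangent = "('b, 'e) chart \<Rightarrow> 'e"

definition vel :: "('b, 'e::real_normed_vector) manifold \<Rightarrow> (real \<Rightarrow> 'b) \<Rightarrow> ('b, 'e) tangent" where
  "vel M \<gamma> = (\<lambda>c. if c \<in> atlas M \<and> \<gamma> 0 \<in> fst c
     then vector_derivative (snd c \<circ> \<gamma>) (at 0) else 0)"

text \<open>Velocities in Euclidean space and in the product of Euclidean space with \<open>M\<close>, under the
  canonical identifications of their tangent spaces with \<open>'a\<close> and with \<open>'a \<times> T\<^sub>yM\<close>.\<close>

definition evel :: "(real \<Rightarrow> 'a::real_normed_vector) \<Rightarrow> 'a" where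
  "evel \<gamma> = vector_derivative \<gamma> (at 0)"

definition pvel :: "('b, 'e::real_normed_vector) manifold \<Rightarrow> (real \<Rightarrow> 'a::real_normed_vector \<times> 'b)
    \<Rightarrow> 'a \<times> ('b, 'e) tangent" where
  "pvel M \<gamma> = (evel (fst \<circ> \<gamma>), vel M (snd \<circ> \<gamma>))"

text \<open>The differential, at the common base point of the curves in \<open>C\<close>, of a map \<open>F\<close>:
  the velocity of \<open>\<gamma>\<close> is sent to the velocity of \<open>F \<circ> \<gamma>\<close>. The first two arguments are the
  velocity maps of domain and codomain.\<close>

definition differential :: "((real \<Rightarrow> 'p) \<Rightarrow> 'u) \<Rightarrow> ((real \<Rightarrow> 'q) \<Rightarrow> 'v) \<Rightarrow> (real \<Rightarrow> 'p) set
    \<Rightarrow> ('p \<Rightarrow> 'q) \<Rightarrow> 'u \<Rightarrow> 'v" where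
  "differential vel1 vel2 C F u = (THE w. \<exists>\<gamma>\<in>C. vel1 \<gamma> = u \<and> vel2 (F \<circ> \<gamma>) = w)"

definition etangent :: "'a::euclidean_space set \<Rightarrow> 'a \<Rightarrow> 'a set" where
  "etangent I x = evel ` curves euclidean_mfd I x"

definition ptangent :: "('b, 'e::real_normed_vector) manifold \<Rightarrow> ('a::euclidean_space \<times> 'b) set
    \<Rightarrow> 'a \<times> 'b \<Rightarrow> ('a \<times> ('b, 'e) tangent) set" where
  "ptangent M Z p = pvel M ` curves (prod_mfd euclidean_mfd M) Z p"

text \<open>For \<open>Z\<close> in the product of Euclidean space and \<open>M\<close>: the differentials at \<open>p\<close> of the coordinate
  projections restricted to \<open>Z\<close>, both with domain \<open>ptangent M Z p\<close>.\<close>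

definition D1 :: "('b, 'e::real_normed_vector) manifold \<Rightarrow> ('a::euclidean_space \<times> 'b) set
    \<Rightarrow> 'a \<times> 'b \<Rightarrow> 'a \<times> ('b, 'e) tangent \<Rightarrow> 'a" where
  "D1 M Z p = differential (pvel M) evel (curves (prod_mfd euclidean_mfd M) Z p) fst"

definition D2 :: "('b, 'e::real_normed_vector) manifold \<Rightarrow> ('a::euclidean_space \<times> 'b) set
    \<Rightarrow> 'a \<times> 'b \<Rightarrow> 'a \<times> ('b, 'e) tangent \<Rightarrow> ('b, 'e) tangent" where
  "D2 M Z p = differential (pvel M) (vel M) (curves (prod_mfd euclidean_mfd M) Z p) snd"


section \<open>Riemannian metrics and operator norms\<close>

text \<open>The tangent vector at \<open>p\<close> whose coordinate vector in the chart \<open>c\<close> is \<open>u\<close>.\<close>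

definition coord_vec ::
  "('b, 'e::real_normed_vector) manifold \<Rightarrow> ('b, 'e) chart \<Rightarrow> 'b \<Rightarrow> 'e \<Rightarrow> ('b, 'e) tangent" where
  "coord_vec M c p u = (\<lambda>d. if d \<in> atlas M \<and> p \<in> fst d
     then frechet_derivative (snd d \<circ> chart_inv c) (at (snd c p)) u else 0)"

definition riemannian_metric :: "('b, 'e::real_normed_vector) manifold
    \<Rightarrow> ('b \<Rightarrow> ('b, 'e) tangent \<Rightarrow> ('b, 'e) tangent \<Rightarrow> real) \<Rightarrow> bool" where
  "riemannian_metric M g \<longleftrightarrow> (\<forall>c\<in>atlas M.
     (\<forall>p\<in>fst c.
        (\<forall>u. linear (\<lambda>v. g p (coord_vec M c p u) (coord_vec M c p v))) \<and>
        (\<forall>u v. g p (coord_vec M c p u) (coord_vec M c p v)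
             = g p (coord_vec M c p v) (coord_vec M c p u)) \<and>
        (\<forall>u. u \<noteq> 0 \<longrightarrow> 0 < g p (coord_vec M c p u) (coord_vec M c p u))) \<and>
     (\<forall>u v. smooth_on (snd c ` fst c)
        (\<lambda>z. g (chart_inv c z) (coord_vec M c (chart_inv c z) u) (coord_vec M c (chart_inv c z) v))))"

text \<open>Spectral norm of a linear map from a subspace \<open>V\<close> of a Euclidean space into the tangent space
  at \<open>y\<close> of a manifold with metric \<open>g\<close>. The supremum is 0 if \<open>V\<close> is the zero space.\<close>

definition spectral_norm :: "('b \<Rightarrow> 'v \<Rightarrow> 'v \<Rightarrow> real) \<Rightarrow> 'b \<Rightarrow> 'a::real_normed_vector set
    \<Rightarrow> ('a \<Rightarrow> 'v) \<Rightarrow> ennreal" where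
  "spectral_norm g y V A = (SUP t\<in>V - {0}. ennreal (sqrt (g y (A t) (A t)) / norm t))"


section \<open>Submanifolds of Euclidean space\<close>

definition normal_space :: "'a::euclidean_space set \<Rightarrow> 'a \<Rightarrow> 'a set" where
  "normal_space I x = (etangent I x)\<^sup>\<bottom>"

text \<open>\<open>Y\<close> is a tangent vector field of \<open>I\<close> near \<open>x\<close>, smoothly extended to a neighbourhood in the
  ambient space; \<open>u\<close> is the normal component of its derivative along \<open>v\<close>.\<close>

definition second_ff :: "'a::euclidean_space set \<Rightarrow> 'a \<Rightarrow> 'a \<Rightarrow> 'a \<Rightarrow> 'a" where
  "second_ff I x v w = (THE u. \<exists>U Y. open U \<and> x \<in> U \<and> smooth_on U Y \<and>
     (\<forall>p\<in>I \<inter> U. Y p \<in> etangent I p) \<and> Y x = w \<and>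
     u \<in> normal_space I x \<and> frechet_derivative Y (at x) v - u \<in> etangent I x)"

definition weingarten :: "'a::euclidean_space set \<Rightarrow> 'a \<Rightarrow> 'a \<Rightarrow> 'a \<Rightarrow> 'a" where
  "weingarten I x \<eta> v = (THE s. s \<in> etangent I x \<and>
     (\<forall>w\<in>etangent I x. s \<bullet> w = second_ff I x v w \<bullet> \<eta>))"

definition H_map :: "'a::euclidean_space set \<Rightarrow> 'a \<Rightarrow> 'a \<Rightarrow> 'a \<Rightarrow> 'a" where
  "H_map I x \<eta> v = v - weingarten I x \<eta> v"

definition normal_bundle_disc :: "'a::euclidean_space set \<Rightarrow> ('a \<Rightarrow> real) \<Rightarrow> ('a \<times> 'a) set" where
  "normal_bundle_disc I \<delta> = {(p, \<eta>). p \<in> I \<and> \<eta> \<in> normal_space I p \<and> norm \<eta> < \<delta> p}"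

definition tube :: "'a::euclidean_space set \<Rightarrow> ('a \<Rightarrow> real) \<Rightarrow> 'a set" where
  "tube I \<delta> = {p + \<eta> | p \<eta>. (p, \<eta>) \<in> normal_bundle_disc I \<delta>}"

definition tubular_radius :: "'a::euclidean_space set \<Rightarrow> ('a \<Rightarrow> real) \<Rightarrow> bool" where
  "tubular_radius I \<delta> \<longleftrightarrow>
     continuous_on I \<delta> \<and> (\<forall>p\<in>I. 0 < \<delta> p) \<and> open (tube I \<delta>) \<and>
     subset_diffeo (normal_bundle_disc I \<delta>) (tube I \<delta>) (\<lambda>(p, \<eta>). p + \<eta>) \<and>
     (\<forall>(p, \<eta>)\<in>normal_bundle_disc I \<delta>. \<forall>q\<in>I. q \<noteq> p \<longrightarrow> dist (p + \<eta>) p < dist (p + \<eta>) q)"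


section \<open>Well-posed tuples and the condition number\<close>

text \<open>A linear map is invertible iff it is a bijection between its domain and codomain.\<close>

definition well_posed :: "'a::euclidean_space set \<Rightarrow> ('b, 'e::real_normed_vector) manifold
    \<Rightarrow> ('a \<times> 'b) set \<Rightarrow> ('a \<times> 'b) set" where
  "well_posed I M S = {p\<in>S. bij_betw (D1 M S p) (ptangent M S p) (etangent I (fst p))}"

text \<open>\<open>S_AP I \<delta> M S\<close> and \<open>S_AP I \<delta> M (well_posed I M S)\<close> are the solution manifold of the
  approximation problem and its well-posed part.\<close>

definition S_AP :: "'a::euclidean_space set \<Rightarrow> ('a \<Rightarrow> real) \<Rightarrow> ('b, 'e) manifold
    \<Rightarrow> ('a \<times> 'b) set \<Rightarrow> ('a \<times> 'b) set" where
  "S_AP I \<delta> M S = {(a, y). a \<in> tube I \<delta> \<and> y \<in> topspace (mtop M) \<and> (closest_point I a, y) \<in> S}"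

definition W_AP :: "'a::euclidean_space set \<Rightarrow> ('a \<Rightarrow> real) \<Rightarrow> ('b, 'e::real_normed_vector) manifold
    \<Rightarrow> ('a \<times> 'b) set \<Rightarrow> ('a \<times> 'b) set" where
  "W_AP I \<delta> M S = S_AP I \<delta> M (well_posed I M S)"

definition kappa_AP :: "'a::euclidean_space set \<Rightarrow> ('a \<Rightarrow> real) \<Rightarrow> ('b, 'e::real_normed_vector) manifold
    \<Rightarrow> ('b \<Rightarrow> ('b, 'e) tangent \<Rightarrow> ('b, 'e) tangent \<Rightarrow> real) \<Rightarrow> ('a \<times> 'b) set \<Rightarrow> 'a \<times> 'b \<Rightarrow> ennreal" where
  "kappa_AP I \<delta> M g S p = (let W = W_AP I \<delta> M S in
     if p \<in> W \<and> bij_betw (D1 M W p) (ptangent M W p) UNIV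
     then spectral_norm g (snd p) UNIV (D2 M W p \<circ> inv_into (ptangent M W p) (D1 M W p))
     else \<infinity>)"

end

theory Submission
  imports Defs
begin

text \<open>
  The condition number of the approximation problem differs from that of the exact problem only by
  the derivative \<open>A\<close> at \<open>a\<close> of the closest-point projection, and \<open>A\<close> is \<open>H\<^sub>\<eta>\<close> inverted on the
  tangent space \<open>T\<close> of \<open>\<I>\<close> at \<open>x\<close>, preceded by the orthogonal projection onto \<open>T\<close>.

  Both facts come from curves. In a slice chart \<open>\<phi>\<close> with slice \<open>V\<close> the gradients of
  \<open>q \<mapsto> \<phi> q \<bullet> \<xi>\<close> with \<open>\<xi> \<in> V\<^sup>\<bottom>\<close> are smooth normal fields that span every normal space; one of
  them takes the value \<open>\<eta> = a - x\<close> at \<open>x\<close>. Let \<open>B\<close> be its derivative there. By the Weingarten equation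
  \<open>H\<^sub>\<eta> v\<close> is the tangential part of \<open>v + B v\<close> (\<open>H_map_grad\<close>).

  A curve \<open>\<sigma>\<close> in \<open>\<I>\<close> through \<open>x\<close> can be pushed off \<open>\<I>\<close> along these normal fields to a curve
  through \<open>a\<close> that projects back to \<open>\<sigma>\<close> (\<open>normal_lift\<close>). Comparing velocities gives
  \<open>A (v + B v + n) = v\<close> for tangent \<open>v\<close> and normal \<open>n\<close>, so \<open>A\<close> vanishes on normal vectors and
  \<open>A (H\<^sub>\<eta> v) = v\<close>. Conversely, projecting the line \<open>a + t u\<close> shows that \<open>H\<^sub>\<eta> (A u)\<close> is the tangential
  part of \<open>u\<close> (\<open>H_A\<close>). In particular \<open>H\<^sub>\<eta>\<close> is always invertible inside the tube.

  The same two constructions identify the tangent space of the well-posed part of the approximation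
  problem at \<open>(a, y)\<close> as the set of all \<open>(v, w)\<close> with \<open>(A v, w)\<close> tangent to \<open>\<S>\<close> at \<open>(x, y)\<close>
  (\<open>ptangent_S_AP_iff\<close>). If \<open>D\<pi>\<^sub>\<I>\<close> is invertible at \<open>(x, y)\<close>, the tangent space of \<open>\<S>\<close> is the graph of a
  map \<open>L\<close> on \<open>T\<close>, hence the other tangent space is the graph of \<open>L \<circ> A\<close> on the whole ambient space. Its
  projection to the ambient space is a bijection and the condition number is the norm of \<open>L \<circ> A\<close>.
  Since \<open>A\<close> ignores normal components and the orthogonal projection does not increase norms, the
  supremum may be taken over \<open>T\<close> only (\<open>spectral_norm_UNIV_eq_subspace\<close>), where \<open>A\<close> is the inverse of
  \<open>H\<^sub>\<eta>\<close>. If \<open>D\<pi>\<^sub>\<I>\<close> is not invertible, then \<open>(a, y)\<close> is not well-posed and both sides are infinite.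
\<close>

section \<open>Calculus of smooth maps\<close>

lemma Ck_on_cong:
  assumes "open X" and "\<And>x. x \<in> X \<Longrightarrow> f x = g x" and "Ck_on k X f"
  shows "Ck_on k X g"
  using assms
proof (induction k arbitrary: f g)
  case 0
  then show ?case
    by (auto cong: continuous_on_cong_simp)
next
  case (Suc k)
  have diff: "f differentiable (at x)" if "x \<in> X" for x
    using Suc.prems(3) that by simp
  have "g differentiable (at x)" if "x \<in> X" for x
    using diff[OF that] has_derivative_transform_within_open[of f _ x UNIV X g] Suc.prems(1,2) that
    unfolding differentiable_def by blast
  moreover have "Ck_on k X (\<lambda>x. frechet_derivative g (at x) v)" for v
  proof (rule Suc.IH[OF Suc.prems(1)])
    show "Ck_on k X (\<lambda>x. frechet_derivative f (at x) v)"
      using Suc.prems(3) by simp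
    show "frechet_derivative f (at x) v = frechet_derivative g (at x) v" if "x \<in> X" for x
      using frechet_derivative_transform_within_open[OF diff[OF that] Suc.prems(1) that Suc.prems(2)]
      by simp
  qed
  ultimately show ?case
    by simp
qed

lemma Ck_on_subset: "Ck_on k X f \<Longrightarrow> Y \<subseteq> X \<Longrightarrow> Ck_on k Y f"
  by (induction k arbitrary: f) (auto intro: continuous_on_subset)

lemma Ck_on_Suc_imp_Ck_on: "Ck_on (Suc k) X f \<Longrightarrow> Ck_on k X f"
proof (induction k arbitrary: f)
  case 0
  then show ?case
    by (auto intro!: continuous_at_imp_continuous_on differentiable_imp_continuous_within)
next
  case (Suc k)
  then show ?case
    by (metis Ck_on.simps(2))
qed

lemma Ck_on_UN:
  assumes "\<And>i. i \<in> A \<Longrightarrow> open (X i)" and "\<And>i. i \<in> A \<Longrightarrow> Ck_on k (X i) f"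
  shows "Ck_on k (\<Union>i\<in>A. X i) f"
  using assms by (induction k arbitrary: f) (auto intro: continuous_on_open_UN)

lemma Ck_on_const: "Ck_on k X (\<lambda>x. c)"
  by (induction k arbitrary: c) (auto simp: frechet_derivative_const)

text \<open>The closure properties below are all proved by induction on the order: the derivative of the
  composite map is built from the data and their derivatives in the same way, so the induction
  hypothesis applies to it.\<close>

lemma Ck_on_bounded_linear:
  assumes "bounded_linear L" and "open X" and "Ck_on k X f"
  shows "Ck_on k X (\<lambda>x. L (f x))"
  using assms(3)
proof (induction k arbitrary: f)
  case 0
  then show ?case
    using bounded_linear.continuous_on[OF assms(1)] by simp
next
  case (Suc k)
  have der: "((\<lambda>x. L (f x)) has_derivative (\<lambda>v. L (frechet_derivative f (at x) v))) (at x)"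
    if "x \<in> X" for x
    using Suc.prems that
    by (auto intro!: bounded_linear.has_derivative[OF assms(1)] simp: frechet_derivative_works[symmetric])
  have "Ck_on k X (\<lambda>x. frechet_derivative (\<lambda>x. L (f x)) (at x) v)" for v
  proof (rule Ck_on_cong[OF assms(2)])
    show "Ck_on k X (\<lambda>x. L (frechet_derivative f (at x) v))"
      using Suc by simp
    show "L (frechet_derivative f (at x) v) = frechet_derivative (\<lambda>x. L (f x)) (at x) v"
      if "x \<in> X" for x
      by (rule fun_cong[OF frechet_derivative_at[OF der[OF that]]])
  qed
  then show ?case
    using der by (auto simp: differentiable_def)
qed

lemma Ck_on_add:
  assumes "open X" and "Ck_on k X f" and "Ck_on k X g"
  shows "Ck_on k X (\<lambda>x. f x + g x)"
  using assms(2,3)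
proof (induction k arbitrary: f g)
  case 0
  then show ?case
    by (simp add: continuous_on_add)
next
  case (Suc k)
  have der: "((\<lambda>x. f x + g x) has_derivative
      (\<lambda>v. frechet_derivative f (at x) v + frechet_derivative g (at x) v)) (at x)"
    if "x \<in> X" for x
    using Suc.prems that by (auto intro!: has_derivative_add simp: frechet_derivative_works[symmetric])
  have "Ck_on k X (\<lambda>x. frechet_derivative (\<lambda>x. f x + g x) (at x) v)" for v
  proof (rule Ck_on_cong[OF assms(1)])
    show "Ck_on k X (\<lambda>x. frechet_derivative f (at x) v + frechet_derivative g (at x) v)"
      using Suc by simp
    show "frechet_derivative f (at x) v + frechet_derivative g (at x) v
        = frechet_derivative (\<lambda>x. f x + g x) (at x) v" if "x \<in> X" for x
      by (rule fun_cong[OF frechet_derivative_at[OF der[OF that]]])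
  qed
  then show ?case
    using der by (auto simp: differentiable_def)
qed

lemma Ck_on_sum:
  assumes "open X" and "finite A" and "\<And>i. i \<in> A \<Longrightarrow> Ck_on k X (f i)"
  shows "Ck_on k X (\<lambda>x. \<Sum>i\<in>A. f i x)"
  using assms(2,3)
proof (induction A)
  case empty
  then show ?case
    by (simp only: sum.empty Ck_on_const)
next
  case (insert i A)
  then show ?case
    by (simp add: Ck_on_add[OF assms(1)])
qed

lemma Ck_on_scaleR:
  assumes "open X" and "Ck_on k X f" and "Ck_on k X g"
  shows "Ck_on k X (\<lambda>x. f x *\<^sub>R g x)"
  using assms(2,3)
proof (induction k arbitrary: f g)
  case 0
  then show ?case
    by (simp add: continuous_on_scaleR)
next
  case (Suc k)
  have der: "((\<lambda>x. f x *\<^sub>R g x) has_derivative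
      (\<lambda>v. f x *\<^sub>R frechet_derivative g (at x) v + frechet_derivative f (at x) v *\<^sub>R g x)) (at x)"
    if "x \<in> X" for x
    using Suc.prems that
    by (auto intro!: has_derivative_scaleR simp: frechet_derivative_works[symmetric])
  have "Ck_on k X (\<lambda>x. frechet_derivative (\<lambda>x. f x *\<^sub>R g x) (at x) v)" for v
  proof (rule Ck_on_cong[OF assms(1)])
    show "Ck_on k X (\<lambda>x. f x *\<^sub>R frechet_derivative g (at x) v + frechet_derivative f (at x) v *\<^sub>R g x)"
      using Suc.prems Suc.prems[THEN Ck_on_Suc_imp_Ck_on]
      by (intro Ck_on_add[OF assms(1)] Suc.IH) simp_all
    show "f x *\<^sub>R frechet_derivative g (at x) v + frechet_derivative f (at x) v *\<^sub>R g x
        = frechet_derivative (\<lambda>x. f x *\<^sub>R g x) (at x) v" if "x \<in> X" for x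
      by (rule fun_cong[OF frechet_derivative_at[OF der[OF that]]])
  qed
  then show ?case
    using der by (auto simp: differentiable_def)
qed

lemma linear_Basis_expansion:
  fixes L :: "'a::euclidean_space \<Rightarrow> 'b::real_vector"
  assumes "linear L"
  shows "L w = (\<Sum>b\<in>Basis. (w \<bullet> b) *\<^sub>R L b)"
proof -
  have "L w = L (\<Sum>b\<in>Basis. (w \<bullet> b) *\<^sub>R b)"
    by (simp add: euclidean_representation)
  then show ?thesis
    by (simp add: linear_sum[OF assms] linear_cmul[OF assms])
qed

text \<open>The derivative of the outer map is only known one direction at a time. Expanding the inner
  derivative in an orthonormal basis brings the chain rule into that form.\<close>

lemma Ck_on_compose:
  fixes f :: "'c::real_normed_vector \<Rightarrow> 'a::euclidean_space"
  assumes "open X" and "f ` X \<subseteq> Y" and "Ck_on k X f" and "Ck_on k Y g"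
  shows "Ck_on k X (\<lambda>x. g (f x))"
  using assms(3,4)
proof (induction k arbitrary: g)
  case 0
  then show ?case
    using continuous_on_compose2[OF _ _ assms(2)] by auto
next
  case (Suc k)
  have der: "((\<lambda>x. g (f x)) has_derivative
      (\<lambda>v. frechet_derivative g (at (f x)) (frechet_derivative f (at x) v))) (at x)"
    if "x \<in> X" for x
  proof (rule has_derivative_compose[where f' = "frechet_derivative f (at x)"
        and g' = "frechet_derivative g (at (f x))"])
    show "(f has_derivative frechet_derivative f (at x)) (at x)"
      using Suc.prems(1) that by (simp add: frechet_derivative_works[symmetric])
    show "(g has_derivative frechet_derivative g (at (f x))) (at (f x))"
      using Suc.prems(2) that assms(2) by (auto simp: frechet_derivative_works[symmetric])
  qed
  have "Ck_on k X (\<lambda>x. frechet_derivative (\<lambda>x. g (f x)) (at x) v)" for v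
  proof (rule Ck_on_cong[OF assms(1)])
    have "Ck_on k X (\<lambda>x. frechet_derivative f (at x) v)"
      using Suc.prems by simp
    then have "Ck_on k X (\<lambda>x. frechet_derivative f (at x) v \<bullet> b)" for b
      by (rule Ck_on_bounded_linear[OF bounded_linear_inner_left assms(1)])
    moreover have "Ck_on k X (\<lambda>x. frechet_derivative g (at (f x)) b)" for b
      using Suc.IH[OF Ck_on_Suc_imp_Ck_on[OF Suc.prems(1)], of "\<lambda>x. frechet_derivative g (at x) b"]
        Suc.prems(2)
      by simp
    ultimately show "Ck_on k X (\<lambda>x. \<Sum>b\<in>Basis.
        (frechet_derivative f (at x) v \<bullet> b) *\<^sub>R frechet_derivative g (at (f x)) b)"
      by (intro Ck_on_sum[OF assms(1) finite_Basis] Ck_on_scaleR[OF assms(1)])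
    fix x
    assume "x \<in> X"
    then have "linear (frechet_derivative g (at (f x)))"
      using Suc.prems(2) assms(2) by (intro linear_frechet_derivative) auto
    then have "(\<Sum>b\<in>Basis. (frechet_derivative f (at x) v \<bullet> b) *\<^sub>R frechet_derivative g (at (f x)) b)
        = frechet_derivative g (at (f x)) (frechet_derivative f (at x) v)"
      by (rule linear_Basis_expansion[symmetric])
    also have "\<dots> = frechet_derivative (\<lambda>x. g (f x)) (at x) v"
      by (rule fun_cong[OF frechet_derivative_at[OF der[OF \<open>x \<in> X\<close>]]])
    finally show "(\<Sum>b\<in>Basis.
        (frechet_derivative f (at x) v \<bullet> b) *\<^sub>R frechet_derivative g (at (f x)) b)
        = frechet_derivative (\<lambda>x. g (f x)) (at x) v" .
  qed
  then show ?case
    using der by (auto simp: differentiable_def)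
qed

lemma smooth_on_cong: "open X \<Longrightarrow> (\<And>x. x \<in> X \<Longrightarrow> f x = g x) \<Longrightarrow> smooth_on X f \<Longrightarrow> smooth_on X g"
  unfolding smooth_on_def using Ck_on_cong by blast

lemma smooth_on_subset: "smooth_on X f \<Longrightarrow> Y \<subseteq> X \<Longrightarrow> smooth_on Y f"
  unfolding smooth_on_def using Ck_on_subset by blast

lemma smooth_on_UN:
  "(\<And>i. i \<in> A \<Longrightarrow> open (X i)) \<Longrightarrow> (\<And>i. i \<in> A \<Longrightarrow> smooth_on (X i) f) \<Longrightarrow> smooth_on (\<Union>i\<in>A. X i) f"
  unfolding smooth_on_def by (simp add: Ck_on_UN)

lemma smooth_on_const: "smooth_on X (\<lambda>x. c)"
  unfolding smooth_on_def by (simp add: Ck_on_const)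

lemma smooth_on_bounded_linear:
  "bounded_linear L \<Longrightarrow> open X \<Longrightarrow> smooth_on X f \<Longrightarrow> smooth_on X (\<lambda>x. L (f x))"
  unfolding smooth_on_def using Ck_on_bounded_linear by blast

lemma smooth_on_add:
  "open X \<Longrightarrow> smooth_on X f \<Longrightarrow> smooth_on X g \<Longrightarrow> smooth_on X (\<lambda>x. f x + g x)"
  unfolding smooth_on_def using Ck_on_add by blast

lemma smooth_on_scaleR:
  "open X \<Longrightarrow> smooth_on X f \<Longrightarrow> smooth_on X g \<Longrightarrow> smooth_on X (\<lambda>x. f x *\<^sub>R g x)"
  unfolding smooth_on_def using Ck_on_scaleR by blast

lemma smooth_on_sum:
  "open X \<Longrightarrow> finite A \<Longrightarrow> (\<And>i. i \<in> A \<Longrightarrow> smooth_on X (f i)) \<Longrightarrow> smooth_on X (\<lambda>x. \<Sum>i\<in>A. f i x)"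
  unfolding smooth_on_def using Ck_on_sum by blast

lemma smooth_on_compose:
  fixes f :: "'c::real_normed_vector \<Rightarrow> 'a::euclidean_space"
  shows "open X \<Longrightarrow> f ` X \<subseteq> Y \<Longrightarrow> smooth_on X f \<Longrightarrow> smooth_on Y g \<Longrightarrow> smooth_on X (\<lambda>x. g (f x))"
  unfolding smooth_on_def using Ck_on_compose by blast

lemma smooth_on_Pair:
  fixes f :: "'a::real_normed_vector \<Rightarrow> 'b::real_normed_vector"
    and g :: "'a \<Rightarrow> 'c::real_normed_vector"
  assumes "open X" and "smooth_on X f" and "smooth_on X g"
  shows "smooth_on X (\<lambda>x. (f x, g x))"
proof -
  have "smooth_on X (\<lambda>x. (f x, 0 :: 'c))"
    by (rule smooth_on_bounded_linear[OF bounded_linear_Pair[OF bounded_linear_ident bounded_linear_zero] assms(1,2)])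
  moreover have "smooth_on X (\<lambda>x. (0 :: 'b, g x))"
    by (rule smooth_on_bounded_linear[OF bounded_linear_Pair[OF bounded_linear_zero bounded_linear_ident] assms(1,3)])
  ultimately show ?thesis
    using smooth_on_add[OF assms(1)] by force
qed

lemma smooth_on_differentiable: "smooth_on X f \<Longrightarrow> x \<in> X \<Longrightarrow> f differentiable (at x)"
  unfolding smooth_on_def by (metis Ck_on.simps(2))

lemma smooth_on_has_derivative:
  "smooth_on X f \<Longrightarrow> x \<in> X \<Longrightarrow> (f has_derivative frechet_derivative f (at x)) (at x)"
  using smooth_on_differentiable frechet_derivative_works by blast

lemma smooth_on_frechet_derivative: "smooth_on X f \<Longrightarrow> smooth_on X (\<lambda>x. frechet_derivative f (at x) v)"
  unfolding smooth_on_def by (metis Ck_on.simps(2))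

lemma smooth_on_imp_continuous_on: "smooth_on X f \<Longrightarrow> continuous_on X f"
  unfolding smooth_on_def by (metis Ck_on.simps(1))

lemma smooth_on_affine: "smooth_on X (\<lambda>t::real. p + t *\<^sub>R v)"
proof -
  have der: "((\<lambda>t::real. p + t *\<^sub>R v) has_derivative (\<lambda>h. h *\<^sub>R v)) (at t)" for t
    by (rule has_derivative_eq_rhs, (rule derivative_intros)+) simp
  have "Ck_on (Suc k) X (\<lambda>t::real. p + t *\<^sub>R v)" for k
  proof -
    have "(\<lambda>t::real. p + t *\<^sub>R v) differentiable (at t)" for t
      using der by (auto simp: differentiable_def)
    moreover have "frechet_derivative (\<lambda>t::real. p + t *\<^sub>R v) (at t) = (\<lambda>h. h *\<^sub>R v)" for t
      by (rule frechet_derivative_at[OF der, symmetric])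
    ultimately show ?thesis
      by (simp add: Ck_on_const)
  qed
  then show ?thesis
    unfolding smooth_on_def using Ck_on_Suc_imp_Ck_on by blast
qed

lemma smooth_on_has_evel:
  fixes \<gamma> :: "real \<Rightarrow> 'a::real_normed_vector"
  assumes "smooth_on J \<gamma>" and "0 \<in> J"
  shows "(\<gamma> has_vector_derivative evel \<gamma>) (at 0)"
  using smooth_on_differentiable[OF assms] unfolding evel_def
  by (simp add: vector_derivative_works[symmetric])

lemma evel_eqI: "(\<gamma> has_vector_derivative v) (at 0) \<Longrightarrow> evel \<gamma> = v"
  unfolding evel_def by (rule vector_derivative_at)

lemma evel_compose:
  assumes "smooth_on J \<gamma>" and "0 \<in> J" and "f differentiable (at (\<gamma> 0))"
  shows "((\<lambda>t. f (\<gamma> t)) has_vector_derivative frechet_derivative f (at (\<gamma> 0)) (evel \<gamma>)) (at 0)"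
proof -
  have "linear (frechet_derivative f (at (\<gamma> 0)))"
    using assms(3) by (rule linear_frechet_derivative)
  moreover have "((\<lambda>t. f (\<gamma> t)) has_derivative
      (\<lambda>h. frechet_derivative f (at (\<gamma> 0)) (h *\<^sub>R evel \<gamma>))) (at 0)"
    using smooth_on_has_evel[OF assms(1,2)] assms(3)
    unfolding has_vector_derivative_def frechet_derivative_works
    by (rule has_derivative_compose)
  ultimately show ?thesis
    by (simp add: has_vector_derivative_def linear_cmul)
qed

section \<open>Smooth paths and tangent spaces\<close>

text \<open>The condition that makes a path a smooth curve, over an arbitrary open time domain instead of a
  symmetric interval, so that domains can be cut down by intersection.\<close>

definition smooth_path :: "real set \<Rightarrow> ('b, 'e::real_normed_vector) manifold \<Rightarrow> (real \<Rightarrow> 'b) \<Rightarrow> bool" where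
  "smooth_path J M \<gamma> \<longleftrightarrow> continuous_map (top_of_set J) (mtop M) \<gamma> \<and>
     (\<forall>c\<in>atlas M. smooth_on {t\<in>J. \<gamma> t \<in> fst c} (snd c \<circ> \<gamma>))"

lemma smooth_path_subset:
  assumes "smooth_path J M \<gamma>" and "K \<subseteq> J"
  shows "smooth_path K M \<gamma>"
  unfolding smooth_path_def
proof (intro conjI ballI)
  show "continuous_map (top_of_set K) (mtop M) \<gamma>"
    using assms continuous_map_from_subtopology_mono unfolding smooth_path_def by blast
  fix c
  assume "c \<in> atlas M"
  then show "smooth_on {t \<in> K. \<gamma> t \<in> fst c} (snd c \<circ> \<gamma>)"
    using assms unfolding smooth_path_def by (blast intro: smooth_on_subset)
qed

lemma curves_iff_smooth_path:
  "\<gamma> \<in> curves M Z p \<longleftrightarrow> \<gamma> 0 = p \<and> (\<exists>J. open J \<and> 0 \<in> J \<and> smooth_path J M \<gamma> \<and> \<gamma> ` J \<subseteq> Z)"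
proof (intro iffI conjI; (elim conjE exE)?)
  assume "\<gamma> \<in> curves M Z p"
  then show "\<gamma> 0 = p"
    by (simp add: curves_def)
  from \<open>\<gamma> \<in> curves M Z p\<close> obtain \<epsilon> where "\<epsilon> > 0" "smooth_path {-\<epsilon><..<\<epsilon>} M \<gamma>" "\<gamma> ` {-\<epsilon><..<\<epsilon>} \<subseteq> Z"
    unfolding curves_def smooth_path_def by blast
  then show "\<exists>J. open J \<and> 0 \<in> J \<and> smooth_path J M \<gamma> \<and> \<gamma> ` J \<subseteq> Z"
    by (intro exI[of _ "{-\<epsilon><..<\<epsilon>}"]) simp
next
  fix J
  assume J: "\<gamma> 0 = p" "open J" "0 \<in> J" "smooth_path J M \<gamma>" "\<gamma> ` J \<subseteq> Z"
  then obtain \<epsilon> where "\<epsilon> > 0" "ball 0 \<epsilon> \<subseteq> J"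
    by (meson openE)
  then have "{-\<epsilon><..<\<epsilon>} \<subseteq> J"
    by (simp add: ball_eq_greaterThanLessThan)
  with J \<open>\<epsilon> > 0\<close> show "\<gamma> \<in> curves M Z p"
    using smooth_path_subset[OF J(4), of "{-\<epsilon><..<\<epsilon>}"] unfolding curves_def smooth_path_def by blast
qed

lemma smooth_path_euclidean:
  "smooth_path J euclidean_mfd \<gamma> \<longleftrightarrow> smooth_on J \<gamma>"
  using smooth_on_imp_continuous_on[of J \<gamma>]
  by (auto simp: smooth_path_def euclidean_mfd_def)

lemma etangent_iff:
  "v \<in> etangent I p \<longleftrightarrow>
    (\<exists>\<gamma> J. open J \<and> 0 \<in> J \<and> smooth_on J \<gamma> \<and> \<gamma> ` J \<subseteq> I \<and> \<gamma> 0 = p \<and> evel \<gamma> = v)"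
  unfolding etangent_def image_iff Bex_def curves_iff_smooth_path smooth_path_euclidean by blast

lemma open_preimage_of_openin:
  assumes "open J" and "continuous_map (top_of_set J) X \<gamma>" and "openin X G"
  shows "open {t \<in> J. \<gamma> t \<in> G}"
  using openin_continuous_map_preimage[OF assms(2,3)] assms(1) by (simp add: openin_open_eq)

text \<open>The charts of the product see the Euclidean component of a path only while the other component
  is inside some chart of \<open>M\<close>. These times form an open cover of the time domain, and smoothness is
  local.\<close>

lemma smooth_path_prod_iff:
  fixes \<gamma> :: "real \<Rightarrow> 'a::euclidean_space \<times> 'b"
  assumes M: "smooth_manifold M" and J: "open J"
  shows "smooth_path J (prod_mfd euclidean_mfd M) \<gamma> \<longleftrightarrow>
    smooth_on J (fst \<circ> \<gamma>) \<and> smooth_path J M (snd \<circ> \<gamma>)"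
proof -
  define K where "K c = {t \<in> J. snd (\<gamma> t) \<in> fst c}" for c :: "('b, 'c) chart"
  have top: "continuous_map (top_of_set J) (mtop (prod_mfd euclidean_mfd M)) \<gamma> \<longleftrightarrow>
      continuous_on J (fst \<circ> \<gamma>) \<and> continuous_map (top_of_set J) (mtop M) (snd \<circ> \<gamma>)"
    by (simp add: prod_mfd_def euclidean_mfd_def continuous_map_pairwise)
  have charts: "(\<forall>c\<in>atlas (prod_mfd euclidean_mfd M). smooth_on {t\<in>J. \<gamma> t \<in> fst c} (snd c \<circ> \<gamma>)) \<longleftrightarrow>
      (\<forall>c\<in>atlas M. smooth_on (K c) (\<lambda>t. (fst (\<gamma> t), snd c (snd (\<gamma> t)))))"
  proof -
    have "atlas (prod_mfd euclidean_mfd M) =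
        (\<lambda>c. (UNIV \<times> fst c, map_prod (id :: 'a \<Rightarrow> 'a) (snd c))) ` atlas M"
      unfolding prod_mfd_def euclidean_mfd_def image_def by (simp add: Bex_def) blast
    then show ?thesis
      by (simp add: K_def o_def mem_Times_iff map_prod_def case_prod_unfold)
  qed
  have *: "open (K c)" if "c \<in> atlas M" "continuous_map (top_of_set J) (mtop M) (snd \<circ> \<gamma>)" for c
    using open_preimage_of_openin[OF J that(2), of "fst c"] M that(1)
    unfolding K_def smooth_manifold_def is_chart_def by auto
  show ?thesis
  proof (intro iffI conjI)
    assume L: "smooth_path J (prod_mfd euclidean_mfd M) \<gamma>"
    then have cont: "continuous_map (top_of_set J) (mtop M) (snd \<circ> \<gamma>)"
      using top by (simp add: smooth_path_def)
    have pair: "smooth_on (K c) (\<lambda>t. (fst (\<gamma> t), snd c (snd (\<gamma> t))))" if "c \<in> atlas M" for c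
      using L charts that by (simp add: smooth_path_def)
    have "smooth_on (K c) (snd c \<circ> (snd \<circ> \<gamma>))" if "c \<in> atlas M" for c
      using smooth_on_bounded_linear[OF bounded_linear_snd *[OF that cont] pair[OF that]]
      by (simp add: o_def)
    then show "smooth_path J M (snd \<circ> \<gamma>)"
      using cont by (simp add: smooth_path_def K_def)
    have "smooth_on (K c) (fst \<circ> \<gamma>)" if "c \<in> atlas M" for c
      using smooth_on_bounded_linear[OF bounded_linear_fst *[OF that cont] pair[OF that]]
      by (simp add: o_def)
    then have "smooth_on (\<Union>c\<in>atlas M. K c) (fst \<circ> \<gamma>)"
      using * cont by (intro smooth_on_UN) auto
    moreover have "(\<Union>c\<in>atlas M. K c) = J"
    proof -
      have "snd (\<gamma> t) \<in> (\<Union>c\<in>atlas M. fst c)" if "t \<in> J" for t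
        using continuous_map_funspace[OF cont] M that unfolding smooth_manifold_def by auto
      then show ?thesis
        by (auto simp: K_def)
    qed
    ultimately show "smooth_on J (fst \<circ> \<gamma>)"
      by simp
  next
    assume R: "smooth_on J (fst \<circ> \<gamma>) \<and> smooth_path J M (snd \<circ> \<gamma>)"
    then have cont: "continuous_map (top_of_set J) (mtop M) (snd \<circ> \<gamma>)"
      by (simp add: smooth_path_def)
    have "smooth_on (K c) (\<lambda>t. (fst (\<gamma> t), snd c (snd (\<gamma> t))))" if "c \<in> atlas M" for c
    proof (rule smooth_on_Pair)
      show "open (K c)"
        using * that cont by simp
      show "smooth_on (K c) (\<lambda>t. fst (\<gamma> t))"
        using R smooth_on_subset[of J "fst \<circ> \<gamma>" "K c"] by (auto simp: K_def o_def)
      show "smooth_on (K c) (\<lambda>t. snd c (snd (\<gamma> t)))"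
        using R that by (simp add: smooth_path_def K_def o_def)
    qed
    then show "smooth_path J (prod_mfd euclidean_mfd M) \<gamma>"
      using R cont charts top smooth_on_imp_continuous_on[of J "fst \<circ> \<gamma>"]
      by (simp add: smooth_path_def)
  qed
qed

lemma ptangent_iff:
  fixes Z :: "('a::euclidean_space \<times> 'b) set"
  assumes "smooth_manifold M"
  shows "(v, w) \<in> ptangent M Z (p, q) \<longleftrightarrow> (\<exists>J \<sigma> \<beta>. open J \<and> 0 \<in> J \<and> smooth_on J \<sigma> \<and> smooth_path J M \<beta> \<and>
    (\<forall>t\<in>J. (\<sigma> t, \<beta> t) \<in> Z) \<and> \<sigma> 0 = p \<and> \<beta> 0 = q \<and> evel \<sigma> = v \<and> vel M \<beta> = w)"
proof
  assume "(v, w) \<in> ptangent M Z (p, q)"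
  then obtain \<gamma> where g: "\<gamma> \<in> curves (prod_mfd euclidean_mfd M) Z (p, q)" "(v, w) = pvel M \<gamma>"
    unfolding ptangent_def by blast
  then obtain J where J: "open J" "0 \<in> J" "smooth_path J (prod_mfd euclidean_mfd M) \<gamma>" "\<gamma> ` J \<subseteq> Z"
      and "\<gamma> 0 = (p, q)"
    unfolding curves_iff_smooth_path by blast
  with g(2) show "\<exists>J \<sigma> \<beta>. open J \<and> 0 \<in> J \<and> smooth_on J \<sigma> \<and> smooth_path J M \<beta> \<and>
    (\<forall>t\<in>J. (\<sigma> t, \<beta> t) \<in> Z) \<and> \<sigma> 0 = p \<and> \<beta> 0 = q \<and> evel \<sigma> = v \<and> vel M \<beta> = w"
    unfolding smooth_path_prod_iff[OF assms J(1)] pvel_def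
    by (intro exI[of _ J] exI[of _ "fst \<circ> \<gamma>"] exI[of _ "snd \<circ> \<gamma>"]) auto
next
  assume "\<exists>J \<sigma> \<beta>. open J \<and> 0 \<in> J \<and> smooth_on J \<sigma> \<and> smooth_path J M \<beta> \<and>
    (\<forall>t\<in>J. (\<sigma> t, \<beta> t) \<in> Z) \<and> \<sigma> 0 = p \<and> \<beta> 0 = q \<and> evel \<sigma> = v \<and> vel M \<beta> = w"
  then obtain J \<sigma> \<beta> where J: "open J" "0 \<in> J" "smooth_on J \<sigma>" "smooth_path J M \<beta>"
      "\<And>t. t \<in> J \<Longrightarrow> (\<sigma> t, \<beta> t) \<in> Z" and v: "\<sigma> 0 = p" "\<beta> 0 = q" "evel \<sigma> = v" "vel M \<beta> = w"
    by blast
  have o: "fst \<circ> (\<lambda>t. (\<sigma> t, \<beta> t)) = \<sigma>" "snd \<circ> (\<lambda>t. (\<sigma> t, \<beta> t)) = \<beta>"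
    by (simp_all add: o_def)
  have "smooth_path J (prod_mfd euclidean_mfd M) (\<lambda>t. (\<sigma> t, \<beta> t))"
    using J by (simp add: smooth_path_prod_iff[OF assms J(1)] o)
  then have "(\<lambda>t. (\<sigma> t, \<beta> t)) \<in> curves (prod_mfd euclidean_mfd M) Z (p, q)"
    using J v by (auto simp: curves_iff_smooth_path)
  then show "(v, w) \<in> ptangent M Z (p, q)"
    using v by (force simp: ptangent_def pvel_def o)
qed

text \<open>In the product with a Euclidean space both projections act on velocities as projections, so
  the differentials of the coordinate projections forget one component of a tangent vector.\<close>

lemma D1_eq_fst: "u \<in> ptangent M Z p \<Longrightarrow> D1 M Z p u = fst u"
  unfolding D1_def differential_def ptangent_def
  by (rule the_equality) (auto simp: pvel_def)

lemma D2_eq_snd: "u \<in> ptangent M Z p \<Longrightarrow> D2 M Z p u = snd u"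
  unfolding D2_def differential_def ptangent_def
  by (rule the_equality) (auto simp: pvel_def)

lemma fst_ptangent_in_etangent:
  assumes "smooth_manifold M" and "Z \<subseteq> I \<times> X" and "(v, w) \<in> ptangent M Z (p, q)"
  shows "v \<in> etangent I p"
  using assms(2,3) unfolding ptangent_iff[OF assms(1)] etangent_iff by blast

lemma zero_in_ptangent:
  fixes M :: "('b, 'c::real_normed_vector) manifold" and Z :: "('a::euclidean_space \<times> 'b) set"
  assumes M: "smooth_manifold M" and "(p, q) \<in> Z" and "q \<in> topspace (mtop M)"
  shows "(0, \<lambda>c. 0) \<in> ptangent M Z (p, q)"
proof -
  have "smooth_path UNIV M (\<lambda>t. q)"
    using assms(3) by (auto simp: smooth_path_def o_def intro: smooth_on_const)
  moreover have "vel M (\<lambda>t. q) = (\<lambda>c. 0)"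
    by (auto simp: vel_def o_def)
  ultimately show ?thesis
    using assms(2) unfolding ptangent_iff[OF M]
    by (intro exI[of _ UNIV] exI[of _ "\<lambda>t. p"] exI[of _ "\<lambda>t. q"])
      (auto simp: smooth_on_const evel_def)
qed

text \<open>The metric is only constrained on coordinate vectors, so the zero tangent vector has to be
  recognized as the one with zero coordinates.\<close>

lemma riemannian_metric_zero:
  assumes M: "smooth_manifold M" and g: "riemannian_metric M g" and q: "q \<in> topspace (mtop M)"
  shows "g q (\<lambda>d. 0) (\<lambda>d. 0) = 0"
proof -
  obtain c where c: "c \<in> atlas M" "q \<in> fst c"
    using M q unfolding smooth_manifold_def by blast
  have "coord_vec M c q 0 = (\<lambda>d. 0)"
  proof
    fix d
    show "coord_vec M c q 0 d = 0"
    proof (cases "d \<in> atlas M \<and> q \<in> fst d")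
      case True
      then have "compatible c d"
        using M c(1) unfolding smooth_manifold_def by simp
      then have "smooth_on (snd c ` (fst c \<inter> fst d)) (snd d \<circ> chart_inv c)"
        unfolding compatible_def by simp
      then have "(snd d \<circ> chart_inv c) differentiable (at (snd c q))"
        by (rule smooth_on_differentiable) (use True c in blast)
      from linear_0[OF linear_frechet_derivative[OF this]] show ?thesis
        by (simp add: coord_vec_def)
    qed (auto simp: coord_vec_def)
  qed
  moreover have "linear (\<lambda>v. g q (coord_vec M c q 0) (coord_vec M c q v))"
    using g c unfolding riemannian_metric_def by blast
  ultimately show ?thesis
    using linear_0 by fastforce
qed

section \<open>Slice charts, normal fields and the Weingarten map\<close>

lemma orthogonal_comp_iff: "z \<in> T\<^sup>\<bottom> \<longleftrightarrow> (\<forall>t\<in>T. t \<bullet> z = 0)"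
  by (simp add: orthogonal_comp_def orthogonal_def)

lemma orthogonal_decomposition:
  fixes T :: "'a::euclidean_space set"
  assumes "subspace T"
  obtains t n where "t \<in> T" "n \<in> T\<^sup>\<bottom>" "z = t + n"
  using subspace_sum_orthogonal_comp[OF assms] set_plus_elim[of z T "T\<^sup>\<bottom>"] by blast

lemma orthogonal_comp_disjoint: "z \<in> T \<Longrightarrow> z \<in> T\<^sup>\<bottom> \<Longrightarrow> z = 0"
  by (auto simp: orthogonal_comp_iff)

lemma has_vector_derivative_locally_zero:
  fixes f :: "real \<Rightarrow> 'a::real_normed_vector"
  assumes "(f has_vector_derivative d) (at 0)" and "open K" and "0 \<in> K" and "\<And>t. t \<in> K \<Longrightarrow> f t = 0"
  shows "d = 0"
proof -
  have "(f has_vector_derivative 0) (at 0)"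
    by (rule has_vector_derivative_transform_within_open[OF has_vector_derivative_const assms(2,3)])
      (simp add: assms(4))
  with assms(1) show ?thesis
    by (rule vector_derivative_unique_at)
qed

locale slice_chart =
  fixes I U V :: "'a::euclidean_space set" and \<phi> \<psi> :: "'a \<Rightarrow> 'a"
  assumes open_U: "open U" and open_image: "open (\<phi> ` U)"
    and smooth_\<phi>: "smooth_on U \<phi>" and smooth_\<psi>: "smooth_on (\<phi> ` U) \<psi>"
    and \<psi>_\<phi>: "p \<in> U \<Longrightarrow> \<psi> (\<phi> p) = p"
    and subspace_V: "subspace V" and slice: "\<phi> ` (U \<inter> I) = \<phi> ` U \<inter> V"
begin

lemma in_I_iff:
  assumes p: "p \<in> U"
  shows "p \<in> I \<longleftrightarrow> \<phi> p \<in> V"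
proof
  show "p \<in> I \<Longrightarrow> \<phi> p \<in> V"
    using p slice by blast
next
  assume "\<phi> p \<in> V"
  then have "\<phi> p \<in> \<phi> ` (U \<inter> I)"
    unfolding slice using p by (intro IntI imageI)
  then obtain q where "\<phi> p = \<phi> q" "q \<in> U \<inter> I"
    by (rule imageE)
  then have "p = q"
    using \<psi>_\<phi>[OF p] \<psi>_\<phi>[of q] by (metis IntD1)
  then show "p \<in> I"
    using \<open>q \<in> U \<inter> I\<close> by blast
qed

lemma \<psi>_in_U: "z \<in> \<phi> ` U \<Longrightarrow> \<psi> z \<in> U" and \<phi>_\<psi>: "z \<in> \<phi> ` U \<Longrightarrow> \<phi> (\<psi> z) = z"
  using \<psi>_\<phi> by auto

abbreviation d\<phi> :: "'a \<Rightarrow> 'a \<Rightarrow> 'a" where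
  "d\<phi> p \<equiv> frechet_derivative \<phi> (at p)"

abbreviation d\<psi> :: "'a \<Rightarrow> 'a \<Rightarrow> 'a" where
  "d\<psi> z \<equiv> frechet_derivative \<psi> (at z)"

lemma linear_d\<phi>: "p \<in> U \<Longrightarrow> linear (d\<phi> p)"
  by (rule linear_frechet_derivative[OF smooth_on_differentiable[OF smooth_\<phi>]])

lemma linear_d\<psi>: "p \<in> U \<Longrightarrow> linear (d\<psi> (\<phi> p))"
  by (rule linear_frechet_derivative[OF smooth_on_differentiable[OF smooth_\<psi>]]) simp

lemma d\<psi>_d\<phi>:
  assumes "p \<in> U"
  shows "d\<psi> (\<phi> p) (d\<phi> p v) = v"
proof -
  have "((\<lambda>q. \<psi> (\<phi> q)) has_derivative (\<lambda>v. d\<psi> (\<phi> p) (d\<phi> p v))) (at p)"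
    by (rule has_derivative_compose[OF smooth_on_has_derivative[OF smooth_\<phi> assms]
          smooth_on_has_derivative[OF smooth_\<psi>]]) (use assms in simp)
  moreover have "((\<lambda>q. \<psi> (\<phi> q)) has_derivative (\<lambda>v. v)) (at p)"
    by (rule has_derivative_transform_within_open[OF has_derivative_ident open_U assms])
      (simp add: \<psi>_\<phi>)
  ultimately show ?thesis
    using has_derivative_unique by metis
qed

lemma d\<phi>_d\<psi>:
  assumes "p \<in> U"
  shows "d\<phi> p (d\<psi> (\<phi> p) z) = z"
proof -
  have "((\<lambda>q. \<phi> (\<psi> q)) has_derivative (\<lambda>v. d\<phi> (\<psi> (\<phi> p)) (d\<psi> (\<phi> p) v))) (at (\<phi> p))"
    by (rule has_derivative_compose[OF smooth_on_has_derivative[OF smooth_\<psi>]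
          smooth_on_has_derivative[OF smooth_\<phi>]]) (use assms \<psi>_\<phi> in simp_all)
  moreover have "((\<lambda>q. \<phi> (\<psi> q)) has_derivative (\<lambda>v. v)) (at (\<phi> p))"
    by (rule has_derivative_transform_within_open[OF has_derivative_ident open_image])
      (use assms \<phi>_\<psi> in auto)
  ultimately show ?thesis
    using has_derivative_unique \<psi>_\<phi>[OF assms] by metis
qed

text \<open>The velocity of a curve in \<open>I\<close> is seen by the chart as the velocity of a curve in the linear
  space \<open>V\<close>; conversely, \<open>\<psi>\<close> maps straight lines in \<open>V\<close> to curves in \<open>I\<close>.\<close>

lemma etangent_iff_slice:
  assumes p: "p \<in> U" "p \<in> I"
  shows "v \<in> etangent I p \<longleftrightarrow> d\<phi> p v \<in> V"
proof
  assume "v \<in> etangent I p"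
  then obtain \<gamma> J where g: "open J" "0 \<in> J" "smooth_on J \<gamma>" "\<gamma> ` J \<subseteq> I" "\<gamma> 0 = p" "evel \<gamma> = v"
    unfolding etangent_iff by blast
  define K where "K = {t \<in> J. \<gamma> t \<in> U}"
  have K: "open K" "0 \<in> K"
    using open_preimage_of_openin[of J euclidean \<gamma> U] g smooth_on_imp_continuous_on[OF g(3)] open_U p
    by (auto simp: K_def)
  have der: "((\<lambda>t. \<phi> (\<gamma> t)) has_vector_derivative d\<phi> p v) (at 0)"
    using evel_compose[OF g(3,2), of \<phi>] smooth_on_differentiable[OF smooth_\<phi> p(1)] g by simp
  have "d\<phi> p v \<bullet> \<xi> = 0" if "\<xi> \<in> V\<^sup>\<bottom>" for \<xi>
  proof (rule has_vector_derivative_locally_zero[OF _ K])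
    show "((\<lambda>t. \<phi> (\<gamma> t) \<bullet> \<xi>) has_vector_derivative d\<phi> p v \<bullet> \<xi>) (at 0)"
      by (rule bounded_linear.has_vector_derivative[OF bounded_linear_inner_left der])
    show "\<phi> (\<gamma> t) \<bullet> \<xi> = 0" if "t \<in> K" for t
      using that \<open>\<xi> \<in> V\<^sup>\<bottom>\<close> g(4) in_I_iff by (auto simp: K_def orthogonal_comp_iff)
  qed
  then have "d\<phi> p v \<in> V\<^sup>\<bottom>\<^sup>\<bottom>"
    by (simp add: orthogonal_comp_iff inner_commute)
  then show "d\<phi> p v \<in> V"
    by (simp add: orthogonal_comp_self[OF subspace_V])
next
  assume v: "d\<phi> p v \<in> V"
  define \<alpha> where "\<alpha> t = \<phi> p + t *\<^sub>R d\<phi> p v" for t :: real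
  define J where "J = {t \<in> UNIV. \<alpha> t \<in> \<phi> ` U}"
  have smooth_\<alpha>: "smooth_on X \<alpha>" for X
    unfolding \<alpha>_def by (rule smooth_on_affine)
  have "open J"
    unfolding J_def
    by (rule open_preimage_of_openin[of _ euclidean])
      (use open_image smooth_on_imp_continuous_on[OF smooth_\<alpha>] in auto)
  have "0 \<in> J"
    using p by (simp add: J_def \<alpha>_def)
  have "(\<alpha> has_vector_derivative d\<phi> p v) (at 0)"
    unfolding \<alpha>_def by (auto intro!: derivative_eq_intros)
  then have "evel \<alpha> = d\<phi> p v"
    by (rule evel_eqI)
  then have "evel (\<lambda>t. \<psi> (\<alpha> t)) = v"
    using evel_compose[OF smooth_\<alpha> UNIV_I, of \<psi>] smooth_on_differentiable[OF smooth_\<psi>] p d\<psi>_d\<phi>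
    by (intro evel_eqI) (simp add: \<alpha>_def)
  moreover have "smooth_on J (\<lambda>t. \<psi> (\<alpha> t))"
    by (rule smooth_on_compose[OF \<open>open J\<close> _ smooth_\<alpha> smooth_\<psi>]) (auto simp: J_def)
  moreover have "\<psi> (\<alpha> t) \<in> I" if "t \<in> J" for t
  proof -
    have "\<alpha> t \<in> V"
      using v p in_I_iff subspace_V unfolding \<alpha>_def by (blast intro: subspace_add subspace_scale)
    then show ?thesis
      using that \<psi>_in_U \<phi>_\<psi> in_I_iff[of "\<psi> (\<alpha> t)"] by (simp add: J_def)
  qed
  ultimately show "v \<in> etangent I p"
    unfolding etangent_iff using \<open>open J\<close> \<open>0 \<in> J\<close> p \<psi>_\<phi>
    by (intro exI[of _ "\<lambda>t. \<psi> (\<alpha> t)"] exI[of _ J]) (auto simp: \<alpha>_def)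
qed

lemma subspace_etangent:
  assumes "p \<in> U" "p \<in> I"
  shows "subspace (etangent I p)"
proof -
  have "etangent I p = d\<phi> p -` V"
    by (simp add: set_eq_iff etangent_iff_slice[OF assms])
  then show ?thesis
    using linear_subspace_vimage[OF linear_d\<phi>[OF assms(1)] subspace_V] by simp
qed

text \<open>The gradient of \<open>q \<mapsto> \<phi> q \<bullet> \<xi>\<close>. For \<open>\<xi>\<close> orthogonal to the slice this function vanishes on
  \<open>I\<close>, so its gradient is a normal field; it is smooth because it is given by a formula in
  derivatives of \<open>\<phi>\<close>, without choosing an orthonormal frame.\<close>

definition grad :: "'a \<Rightarrow> 'a \<Rightarrow> 'a" where
  "grad \<xi> p = (\<Sum>b\<in>Basis. (d\<phi> p b \<bullet> \<xi>) *\<^sub>R b)"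

lemma grad_inner:
  assumes "p \<in> U"
  shows "grad \<xi> p \<bullet> v = d\<phi> p v \<bullet> \<xi>"
proof -
  have "d\<phi> p v \<bullet> \<xi> = (\<Sum>b\<in>Basis. (v \<bullet> b) *\<^sub>R d\<phi> p b) \<bullet> \<xi>"
    by (rule arg_cong[where f = "\<lambda>z. z \<bullet> \<xi>", OF linear_Basis_expansion[OF linear_d\<phi>[OF assms]]])
  then show ?thesis
    by (simp add: grad_def inner_sum_left inner_commute[of _ v] inner_sum_right mult.commute)
qed

lemma smooth_grad: "smooth_on U (grad \<xi>)"
proof -
  have "smooth_on U (\<lambda>p. d\<phi> p b \<bullet> \<xi>)" for b
    by (rule smooth_on_bounded_linear[OF bounded_linear_inner_left open_U
          smooth_on_frechet_derivative[OF smooth_\<phi>]])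
  then show ?thesis
    unfolding grad_def by (intro smooth_on_sum smooth_on_scaleR smooth_on_const open_U finite_Basis)
qed

lemma grad_normal:
  assumes "p \<in> U" "p \<in> I" "\<xi> \<in> V\<^sup>\<bottom>"
  shows "grad \<xi> p \<in> normal_space I p"
  unfolding normal_space_def orthogonal_comp_iff
proof
  fix t
  assume "t \<in> etangent I p"
  then have "d\<phi> p t \<in> V"
    by (simp add: etangent_iff_slice[OF assms(1,2)])
  then show "t \<bullet> grad \<xi> p = 0"
    using assms(3) grad_inner[OF assms(1), of \<xi> t] by (simp add: orthogonal_comp_iff inner_commute[of t])
qed

text \<open>The adjoint of \<open>d\<phi> p\<close> is invertible and its inverse, the adjoint of \<open>d\<psi> (\<phi> p)\<close>, carries
  vectors normal to \<open>I\<close> into the complement of the slice.\<close>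

lemma normal_is_grad:
  assumes p: "p \<in> U" "p \<in> I" and "\<nu> \<in> normal_space I p"
  obtains \<xi> where "\<xi> \<in> V\<^sup>\<bottom>" "grad \<xi> p = \<nu>"
proof
  let ?\<xi> = "adjoint (d\<psi> (\<phi> p)) \<nu>"
  have adj: "z \<bullet> ?\<xi> = d\<psi> (\<phi> p) z \<bullet> \<nu>" for z
    by (rule adjoint_works[OF linear_d\<psi>[OF p(1)]])
  show "?\<xi> \<in> V\<^sup>\<bottom>"
    using assms(3) etangent_iff_slice[OF p] d\<phi>_d\<psi>[OF p(1)]
    by (simp add: orthogonal_comp_iff adj normal_space_def)
  show "grad ?\<xi> p = \<nu>"
    by (rule vector_eq_rdot[THEN iffD1])
      (simp add: grad_inner[OF p(1)] adj d\<psi>_d\<phi>[OF p(1)] inner_commute[of _ \<nu>])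
qed

text \<open>A tangent field and a normal field are orthogonal along \<open>I\<close>. Differentiating this identity
  along \<open>I\<close> moves the derivative from the tangent field to the normal field.\<close>

lemma tangent_field_derivative_inner_grad:
  assumes p: "p \<in> U" "p \<in> I" and \<xi>: "\<xi> \<in> V\<^sup>\<bottom>" and v: "v \<in> etangent I p"
    and Y: "open X" "p \<in> X" "smooth_on X Y" "\<And>q. q \<in> I \<inter> X \<Longrightarrow> Y q \<in> etangent I q"
  shows "frechet_derivative Y (at p) v \<bullet> grad \<xi> p = - (Y p \<bullet> frechet_derivative (grad \<xi>) (at p) v)"
proof -
  obtain \<gamma> J where g: "open J" "0 \<in> J" "smooth_on J \<gamma>" "\<gamma> ` J \<subseteq> I" "\<gamma> 0 = p" "evel \<gamma> = v"
    using v unfolding etangent_iff by blast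
  define K where "K = {t \<in> J. \<gamma> t \<in> U \<inter> X}"
  have K: "open K" "0 \<in> K"
    using open_preimage_of_openin[of J euclidean \<gamma> "U \<inter> X"] g smooth_on_imp_continuous_on[OF g(3)]
      open_U p Y
    by (auto simp: K_def)
  have Y': "((\<lambda>t. Y (\<gamma> t)) has_vector_derivative frechet_derivative Y (at p) v) (at 0)"
    using evel_compose[OF g(3,2), of Y] smooth_on_differentiable[OF Y(3,2)] g by simp
  have grad': "((\<lambda>t. grad \<xi> (\<gamma> t)) has_vector_derivative frechet_derivative (grad \<xi>) (at p) v) (at 0)"
    using evel_compose[OF g(3,2), of "grad \<xi>"] smooth_on_differentiable[OF smooth_grad p(1)] g by simp
  have "Y p \<bullet> frechet_derivative (grad \<xi>) (at p) v + frechet_derivative Y (at p) v \<bullet> grad \<xi> p = 0"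
  proof (rule has_vector_derivative_locally_zero[OF _ K])
    show "((\<lambda>t. Y (\<gamma> t) \<bullet> grad \<xi> (\<gamma> t)) has_vector_derivative
        Y p \<bullet> frechet_derivative (grad \<xi>) (at p) v + frechet_derivative Y (at p) v \<bullet> grad \<xi> p) (at 0)"
      using bounded_bilinear.has_vector_derivative[OF bounded_bilinear_inner Y' grad'] g(5) by simp
    show "Y (\<gamma> t) \<bullet> grad \<xi> (\<gamma> t) = 0" if "t \<in> K" for t
    proof -
      have "\<gamma> t \<in> U" "\<gamma> t \<in> I" "Y (\<gamma> t) \<in> etangent I (\<gamma> t)"
        using that g(4) Y(4) by (auto simp: K_def)
      then show ?thesis
        using grad_normal[OF _ _ \<xi>] by (simp add: normal_space_def orthogonal_comp_iff)
    qed
  qed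
  then show ?thesis
    by simp
qed

text \<open>The field that is constant in the coordinates of the slice chart.\<close>

lemma tangent_field_exists:
  assumes p: "p \<in> U" "p \<in> I" and w: "w \<in> etangent I p"
  obtains Y where "smooth_on U Y" "\<And>q. q \<in> I \<inter> U \<Longrightarrow> Y q \<in> etangent I q" "Y p = w"
proof
  let ?Y = "\<lambda>q. d\<psi> (\<phi> q) (d\<phi> p w)"
  show "smooth_on U ?Y"
    using smooth_on_compose[OF open_U order_refl smooth_\<phi>,
        OF smooth_on_frechet_derivative[OF smooth_\<psi>]] .
  show "?Y q \<in> etangent I q" if "q \<in> I \<inter> U" for q
    using that w etangent_iff_slice p d\<phi>_d\<psi> by simp
  show "?Y p = w"
    by (rule d\<psi>_d\<phi>[OF p(1)])
qed

text \<open>The normal fields span the normal space, so the previous identity determines the normal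
  component of the derivative of a tangent field from its value at \<open>p\<close> alone. This makes the second
  fundamental form well defined, and computes it.\<close>

lemma second_ff_inner_grad:
  assumes p: "p \<in> U" "p \<in> I" and \<xi>: "\<xi> \<in> V\<^sup>\<bottom>" and v: "v \<in> etangent I p" and w: "w \<in> etangent I p"
  shows "second_ff I p v w \<bullet> grad \<xi> p = - (w \<bullet> frechet_derivative (grad \<xi>) (at p) v)"
proof -
  \<comment> \<open>The defining property of the second fundamental form.\<close>
  define Q where "Q u \<longleftrightarrow> (\<exists>X Y. open X \<and> p \<in> X \<and> smooth_on X Y \<and>
     (\<forall>q\<in>I \<inter> X. Y q \<in> etangent I q) \<and> Y p = w \<and>
     u \<in> normal_space I p \<and> frechet_derivative Y (at p) v - u \<in> etangent I p)" for u
  have T: "subspace (etangent I p)"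
    by (rule subspace_etangent[OF p])
  have Q_inner: "u \<bullet> grad \<xi>' p = - (w \<bullet> frechet_derivative (grad \<xi>') (at p) v)"
    if "Q u" "\<xi>' \<in> V\<^sup>\<bottom>" for u \<xi>'
  proof -
    from \<open>Q u\<close> obtain X Y where Y: "open X" "p \<in> X" "smooth_on X Y"
      "\<And>q. q\<in>I \<inter> X \<Longrightarrow> Y q \<in> etangent I q" "Y p = w"
      "frechet_derivative Y (at p) v - u \<in> etangent I p"
      unfolding Q_def by blast
    have "(frechet_derivative Y (at p) v - u) \<bullet> grad \<xi>' p = 0"
      using Y(6) grad_normal[OF p that(2)] by (simp add: normal_space_def orthogonal_comp_iff)
    then show ?thesis
      using tangent_field_derivative_inner_grad[OF p that(2) v Y(1-4)] Y(5)
      by (simp add: inner_diff_left)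
  qed
  have "\<exists>u. Q u"
  proof -
    obtain Y where Y: "smooth_on U Y" "\<And>q. q \<in> I \<inter> U \<Longrightarrow> Y q \<in> etangent I q" "Y p = w"
      using tangent_field_exists[OF p w] by blast
    obtain t n where "t \<in> etangent I p" "n \<in> (etangent I p)\<^sup>\<bottom>" "frechet_derivative Y (at p) v = t + n"
      by (rule orthogonal_decomposition[OF T])
    then show ?thesis
      unfolding Q_def normal_space_def using Y open_U p
      by (intro exI[of _ n] exI[of _ U] exI[of _ Y]) simp
  qed
  moreover have "u = u'" if "Q u" "Q u'" for u u'
  proof -
    have N: "u - u' \<in> normal_space I p"
      using that unfolding Q_def normal_space_def by (blast intro: subspace_diff subspace_orthogonal_comp)
    then obtain \<xi>' where "\<xi>' \<in> V\<^sup>\<bottom>" "grad \<xi>' p = u - u'"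
      using normal_is_grad[OF p] by blast
    then have "(u - u') \<bullet> (u - u') = 0"
      using Q_inner[OF that(1)] Q_inner[OF that(2)] by (metis inner_diff_left right_minus_eq)
    then show ?thesis
      by simp
  qed
  ultimately have "Q (THE u. Q u)"
    by (metis theI)
  then have "Q (second_ff I p v w)"
    unfolding second_ff_def Q_def .
  then show ?thesis
    using \<xi> by (rule Q_inner)
qed

text \<open>The Weingarten equation: the Weingarten map is the negative tangential part of the derivative
  of a normal field.\<close>

lemma weingarten_grad:
  assumes p: "p \<in> U" "p \<in> I" and \<xi>: "\<xi> \<in> V\<^sup>\<bottom>" and v: "v \<in> etangent I p"
  shows "weingarten I p (grad \<xi> p) v \<in> etangent I p"
    and "frechet_derivative (grad \<xi>) (at p) v + weingarten I p (grad \<xi> p) v \<in> normal_space I p"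
proof -
  let ?B = "frechet_derivative (grad \<xi>) (at p) v"
  have T: "subspace (etangent I p)"
    by (rule subspace_etangent[OF p])
  obtain t n where tn: "t \<in> etangent I p" "n \<in> (etangent I p)\<^sup>\<bottom>" "?B = t + n"
    by (rule orthogonal_decomposition[OF T])
  have t_inner: "- t \<bullet> w = second_ff I p v w \<bullet> grad \<xi> p" if "w \<in> etangent I p" for w
  proof -
    have "w \<bullet> n = 0"
      using tn(2) that by (simp add: orthogonal_comp_iff)
    then show ?thesis
      using second_ff_inner_grad[OF p \<xi> v that] by (simp add: tn(3) inner_add_right inner_commute[of t w])
  qed
  have "weingarten I p (grad \<xi> p) v = - t"
    unfolding weingarten_def
  proof (rule the_equality)
    show "- t \<in> etangent I p \<and> (\<forall>w\<in>etangent I p. - t \<bullet> w = second_ff I p v w \<bullet> grad \<xi> p)"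
      using tn(1) T t_inner by (simp add: subspace_neg)
  next
    fix s
    assume s: "s \<in> etangent I p \<and> (\<forall>w\<in>etangent I p. s \<bullet> w = second_ff I p v w \<bullet> grad \<xi> p)"
    then have "(s + t) \<bullet> w = 0" if "w \<in> etangent I p" for w
      using t_inner[OF that] that by (simp add: inner_add_left)
    moreover have "s + t \<in> etangent I p"
      using s tn(1) T by (simp add: subspace_add)
    ultimately have "s + t = 0"
      using inner_eq_zero_iff by blast
    then show "s = - t"
      by (simp add: eq_neg_iff_add_eq_0)
  qed
  then show "weingarten I p (grad \<xi> p) v \<in> etangent I p"
    and "?B + weingarten I p (grad \<xi> p) v \<in> normal_space I p"
    using tn T by (simp_all add: subspace_neg normal_space_def)
qed

lemma H_map_grad:
  assumes "p \<in> U" "p \<in> I" and "\<xi> \<in> V\<^sup>\<bottom>" and "v \<in> etangent I p"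
  shows "H_map I p (grad \<xi> p) v \<in> etangent I p"
    and "v + frechet_derivative (grad \<xi>) (at p) v - H_map I p (grad \<xi> p) v \<in> normal_space I p"
  using weingarten_grad[OF assms] subspace_etangent[OF assms(1,2)] assms(4)
  by (simp_all add: H_map_def subspace_diff add.commute)

end

text \<open>Compatibility with the identity chart is smoothness of the chart and of its inverse in the
  ordinary sense.\<close>

lemma embedded_submanifold_slice_chart:
  assumes "embedded_submanifold euclidean_mfd m I" and "p \<in> I"
  obtains U V \<phi> \<psi> where "slice_chart I U V \<phi> \<psi>" "p \<in> U"
proof -
  obtain c V where c: "is_chart euclidean c" "compatible c (UNIV, id)" "p \<in> fst c"
    "subspace V" "snd c ` (fst c \<inter> I) = snd c ` fst c \<inter> V"
    using assms unfolding embedded_submanifold_def euclidean_mfd_def by (simp only: manifold.simps) blast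
  have "homeomorphic_map (subtopology euclidean (fst c)) (top_of_set (snd c ` fst c)) (snd c)"
    using c(1) by (simp add: is_chart_def)
  then have inj: "inj_on (snd c) (fst c)"
    using homeomorphic_imp_injective_map by force
  have "slice_chart I (fst c) V (snd c) (chart_inv c)"
  proof
    show "open (fst c)" "open (snd c ` fst c)"
      using c(1) by (auto simp: is_chart_def)
    show "smooth_on (fst c) (snd c)" "smooth_on (snd c ` fst c) (chart_inv c)"
      using c(2) by (simp_all add: compatible_def chart_inv_def id_def[symmetric])
    show "chart_inv c (snd c q) = q" if "q \<in> fst c" for q
      unfolding chart_inv_def by (rule inv_into_f_f[OF inj that])
  qed (use c in auto)
  then show thesis
    using that c(3) by blast
qed

section \<open>The closest-point projection of a tubular neighbourhood\<close>

lemma closest_point_tubular: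
  assumes "tubular_radius I \<delta>" and "(p, \<nu>) \<in> normal_bundle_disc I \<delta>"
  shows "closest_point I (p + \<nu>) = p"
proof -
  have less: "dist (p + \<nu>) p < dist (p + \<nu>) q" if "q \<in> I" "q \<noteq> p" for q
    using assms that unfolding tubular_radius_def by blast
  have "p \<in> I"
    using assms(2) by (simp add: normal_bundle_disc_def)
  show ?thesis
    unfolding closest_point_def
  proof (rule some_equality)
    show "p \<in> I \<and> (\<forall>y\<in>I. dist (p + \<nu>) p \<le> dist (p + \<nu>) y)"
      using \<open>p \<in> I\<close> less by (metis less_imp_le order_refl)
    show "q = p" if "q \<in> I \<and> (\<forall>y\<in>I. dist (p + \<nu>) q \<le> dist (p + \<nu>) y)" for q
      using \<open>p \<in> I\<close> less that by (metis leD)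
  qed
qed

lemma tube_offset_normal:
  assumes "tubular_radius I \<delta>" and "a \<in> tube I \<delta>"
  shows "(closest_point I a, a - closest_point I a) \<in> normal_bundle_disc I \<delta>"
proof -
  obtain p \<nu> where "a = p + \<nu>" "(p, \<nu>) \<in> normal_bundle_disc I \<delta>"
    using assms(2) unfolding tube_def by blast
  then show ?thesis
    using closest_point_tubular[OF assms(1)] by simp
qed

text \<open>On the tube the closest point is the base point component of the inverse of the
  diffeomorphism \<open>(p, \<nu>) \<mapsto> p + \<nu>\<close>.\<close>

lemma smooth_on_closest_point:
  fixes I :: "'a::euclidean_space set"
  assumes "tubular_radius I \<delta>"
  shows "smooth_on (tube I \<delta>) (closest_point I)"
proof -
  let ?E = "\<lambda>(p, \<nu>). p + \<nu> :: 'a" and ?D = "normal_bundle_disc I \<delta>"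
  have bij: "bij_betw ?E ?D (tube I \<delta>)" and smooth: "subset_smooth (tube I \<delta>) (inv_into ?D ?E)"
    and open_tube: "open (tube I \<delta>)"
    using assms unfolding tubular_radius_def subset_diffeo_def by blast+
  have inv: "fst (inv_into ?D ?E z) = closest_point I z" if "z \<in> tube I \<delta>" for z
  proof -
    obtain p \<nu> where inv: "inv_into ?D ?E z = (p, \<nu>)"
      by fastforce
    have "(p, \<nu>) \<in> ?D"
      using bij_betwE[OF bij_betw_inv_into[OF bij]] that unfolding inv[symmetric] by blast
    moreover have "p + \<nu> = z"
      using bij_betw_inv_into_right[OF bij that] unfolding inv by simp
    ultimately show ?thesis
      using closest_point_tubular[OF assms, of p \<nu>] unfolding inv by simp
  qed
  \<comment> \<open>The inverse extends smoothly only locally, near each point of the open tube.\<close>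
  have "\<exists>X. open X \<and> z \<in> X \<and> X \<subseteq> tube I \<delta> \<and> smooth_on X (closest_point I)" if z: "z \<in> tube I \<delta>" for z
  proof -
    obtain X h where X: "open X" "z \<in> X" "smooth_on X h"
      "\<forall>q\<in>tube I \<delta> \<inter> X. h q = inv_into ?D ?E q"
      using bspec[OF smooth[unfolded subset_smooth_def] z] by (elim exE conjE)
    have "open (X \<inter> tube I \<delta>)"
      using X(1) open_tube by (rule open_Int)
    moreover have "smooth_on (X \<inter> tube I \<delta>) (closest_point I)"
    proof (rule smooth_on_cong[OF \<open>open (X \<inter> tube I \<delta>)\<close>])
      show "smooth_on (X \<inter> tube I \<delta>) (\<lambda>q. fst (h q))"
        by (rule smooth_on_bounded_linear[OF bounded_linear_fst \<open>open (X \<inter> tube I \<delta>)\<close>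
              smooth_on_subset[OF X(3)]]) blast
      show "fst (h q) = closest_point I q" if "q \<in> X \<inter> tube I \<delta>" for q
        using X(4) inv[of q] that by simp
    qed
    ultimately show ?thesis
      using X(2) z by blast
  qed
  then obtain X where X: "\<And>z. z \<in> tube I \<delta> \<Longrightarrow>
      open (X z) \<and> z \<in> X z \<and> X z \<subseteq> tube I \<delta> \<and> smooth_on (X z) (closest_point I)"
    by metis
  then have "smooth_on (\<Union>z\<in>tube I \<delta>. X z) (closest_point I)"
    by (intro smooth_on_UN) auto
  moreover have "(\<Union>z\<in>tube I \<delta>. X z) = tube I \<delta>"
    using X by blast
  ultimately show ?thesis
    by simp
qed

text \<open>A point of the tube together with a slice chart around its closest point and a vector \<open>\<xi>\<close>
  whose gradient field extends the offset \<open>a - x\<close> to a normal field.\<close>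

locale tubular_point = slice_chart I U V \<phi> \<psi>
  for I U V :: "'a::euclidean_space set" and \<phi> \<psi> :: "'a \<Rightarrow> 'a" +
  fixes \<delta> :: "'a \<Rightarrow> real" and a \<xi> :: 'a
  assumes tubular: "tubular_radius I \<delta>" and a_in_tube: "a \<in> tube I \<delta>"
    and base_in_U: "closest_point I a \<in> U"
    and \<xi>_normal: "\<xi> \<in> V\<^sup>\<bottom>" and grad_\<xi>: "grad \<xi> (closest_point I a) = a - closest_point I a"
begin

definition x :: 'a where
  "x = closest_point I a"

abbreviation A :: "'a \<Rightarrow> 'a" where
  "A \<equiv> frechet_derivative (closest_point I) (at a)"

abbreviation B :: "'a \<Rightarrow> 'a" where
  "B \<equiv> frechet_derivative (grad \<xi>) (at x)"

abbreviation T :: "'a set" where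
  "T \<equiv> etangent I x"

abbreviation N :: "'a set" where
  "N \<equiv> normal_space I x"

abbreviation H :: "'a \<Rightarrow> 'a" where
  "H \<equiv> H_map I x (a - x)"

lemma x_in: "x \<in> U" "x \<in> I"
  using base_in_U tube_offset_normal[OF tubular a_in_tube] by (auto simp: x_def normal_bundle_disc_def)

lemma offset: "grad \<xi> x = a - x" "norm (a - x) < \<delta> x"
  using grad_\<xi> tube_offset_normal[OF tubular a_in_tube] by (auto simp: x_def normal_bundle_disc_def)

lemma open_tube: "open (tube I \<delta>)"
  using tubular by (simp add: tubular_radius_def)

lemma subspace_T: "subspace T"
  by (rule subspace_etangent[OF x_in])

lemma subspace_N: "subspace N"
  by (simp add: normal_space_def subspace_orthogonal_comp)

lemma closest_point_differentiable: "closest_point I differentiable (at a)"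
  by (rule smooth_on_differentiable[OF smooth_on_closest_point[OF tubular] a_in_tube])

lemma linear_A: "linear A"
  by (rule linear_frechet_derivative[OF closest_point_differentiable])

lemma evel_closest_point:
  assumes "smooth_on J \<alpha>" and "0 \<in> J" and "\<alpha> 0 = a"
  shows "evel (\<lambda>t. closest_point I (\<alpha> t)) = A (evel \<alpha>)"
  using evel_compose[OF assms(1,2), of "closest_point I"] closest_point_differentiable assms(3)
  by (simp add: evel_eqI)

lemma smooth_on_closest_point_path:
  "open J \<Longrightarrow> \<alpha> ` J \<subseteq> tube I \<delta> \<Longrightarrow> smooth_on J \<alpha> \<Longrightarrow> smooth_on J (\<lambda>t. closest_point I (\<alpha> t))"
  by (rule smooth_on_compose[OF _ _ _ smooth_on_closest_point[OF tubular]])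

text \<open>A path in \<open>I\<close> is moved off \<open>I\<close> along normal fields of the slice chart. The field \<open>grad \<xi>\<close>
  makes the new path start at \<open>a\<close>; a second field, scaled by the time, adds an arbitrary normal
  vector to the velocity.\<close>

lemma normal_lift:
  assumes \<sigma>: "open J" "0 \<in> J" "smooth_on J \<sigma>" "\<sigma> ` J \<subseteq> I" "\<sigma> 0 = x" and n: "n \<in> N"
  obtains K \<alpha> where "open K" "0 \<in> K" "K \<subseteq> J" "smooth_on K \<alpha>" "\<alpha> ` K \<subseteq> tube I \<delta>"
    "\<And>t. t \<in> K \<Longrightarrow> closest_point I (\<alpha> t) = \<sigma> t" "\<alpha> 0 = a" "evel \<alpha> = evel \<sigma> + B (evel \<sigma>) + n"
proof -
  obtain \<zeta> where \<zeta>: "\<zeta> \<in> V\<^sup>\<bottom>" "grad \<zeta> x = n"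
    using normal_is_grad[OF x_in n] by blast
  define \<nu> where "\<nu> t = grad \<xi> (\<sigma> t) + t *\<^sub>R grad \<zeta> (\<sigma> t)" for t
  define J' where "J' = {t \<in> J. \<sigma> t \<in> U}"
  have "continuous_on J \<sigma>"
    by (rule smooth_on_imp_continuous_on[OF \<sigma>(3)])
  then have J': "open J'" "0 \<in> J'" "J' \<subseteq> J"
    using open_preimage_of_openin[of J euclidean \<sigma> U] \<sigma> open_U x_in by (auto simp: J'_def)
  have smooth_\<sigma>: "smooth_on J' \<sigma>"
    by (rule smooth_on_subset[OF \<sigma>(3) J'(3)])
  have smooth_grad_\<sigma>: "smooth_on J' (\<lambda>t. grad \<zeta> (\<sigma> t))" for \<zeta>
    by (rule smooth_on_compose[OF J'(1) _ smooth_\<sigma> smooth_grad]) (auto simp: J'_def)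
  have smooth_\<nu>: "smooth_on J' \<nu>"
    unfolding \<nu>_def using smooth_on_affine[of J' 0 "1 :: real"]
    by (intro smooth_on_add smooth_on_scaleR J'(1) smooth_grad_\<sigma>) simp
  have smooth_\<alpha>: "smooth_on J' (\<lambda>t. \<sigma> t + \<nu> t)"
    by (rule smooth_on_add[OF J'(1) smooth_\<sigma> smooth_\<nu>])
  \<comment> \<open>The times at which the normal vector has not yet reached the boundary of the tube.\<close>
  define K where "K = {t \<in> J'. \<delta> (\<sigma> t) - norm (\<nu> t) \<in> {0<..}}"
  have "continuous_on J' (\<lambda>t. \<delta> (\<sigma> t))"
  proof (rule continuous_on_compose2[of I \<delta> J' \<sigma>])
    show "continuous_on I \<delta>"
      using tubular by (simp add: tubular_radius_def)
    show "continuous_on J' \<sigma>"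
      by (rule smooth_on_imp_continuous_on[OF smooth_\<sigma>])
    show "\<sigma> ` J' \<subseteq> I"
      using \<sigma>(4) J'(3) by blast
  qed
  then have "continuous_on J' (\<lambda>t. \<delta> (\<sigma> t) - norm (\<nu> t))"
    by (intro continuous_on_diff continuous_on_norm smooth_on_imp_continuous_on[OF smooth_\<nu>])
  then have "open K"
    unfolding K_def by (intro open_preimage_of_openin[OF J'(1), of euclidean]) auto
  moreover have "0 \<in> K"
    using J'(2) \<sigma>(5) offset by (simp add: K_def \<nu>_def)
  moreover have "K \<subseteq> J'"
    by (auto simp: K_def)
  moreover have disc: "(\<sigma> t, \<nu> t) \<in> normal_bundle_disc I \<delta>" if "t \<in> K" for t
  proof -
    have "\<sigma> t \<in> U" "\<sigma> t \<in> I" "norm (\<nu> t) < \<delta> (\<sigma> t)"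
      using that \<sigma>(4) by (auto simp: K_def J'_def)
    moreover have "\<nu> t \<in> normal_space I (\<sigma> t)"
      unfolding \<nu>_def normal_space_def
      using grad_normal[OF calculation(1,2)] \<xi>_normal \<zeta>(1)
      by (intro subspace_add subspace_scale subspace_orthogonal_comp) (simp_all add: normal_space_def)
    ultimately show ?thesis
      by (simp add: normal_bundle_disc_def)
  qed
  moreover have "evel (\<lambda>t. \<sigma> t + \<nu> t) = evel \<sigma> + B (evel \<sigma>) + n"
  proof (rule evel_eqI)
    have "((\<lambda>t. grad \<xi> (\<sigma> t)) has_vector_derivative B (evel \<sigma>)) (at 0)"
      using evel_compose[OF \<sigma>(3,2), of "grad \<xi>"] smooth_on_differentiable[OF smooth_grad x_in(1)] \<sigma>(5)
      by simp
    moreover have "((\<lambda>t. t *\<^sub>R grad \<zeta> (\<sigma> t)) has_vector_derivative n) (at 0)"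
      using has_vector_derivative_scaleR[OF DERIV_ident smooth_on_has_evel[OF smooth_grad_\<sigma> J'(2), of \<zeta>]]
        \<sigma>(5) \<zeta>(2) by simp
    ultimately have "((\<lambda>t. \<sigma> t + (grad \<xi> (\<sigma> t) + t *\<^sub>R grad \<zeta> (\<sigma> t))) has_vector_derivative
        evel \<sigma> + (B (evel \<sigma>) + n)) (at 0)"
      by (intro has_vector_derivative_add smooth_on_has_evel[OF \<sigma>(3,2)])
    then show "((\<lambda>t. \<sigma> t + \<nu> t) has_vector_derivative evel \<sigma> + B (evel \<sigma>) + n) (at 0)"
      by (simp add: \<nu>_def add.assoc)
  qed
  moreover have "\<sigma> 0 + \<nu> 0 = a"
    using \<sigma>(5) offset(1) by (simp add: \<nu>_def)
  moreover have "\<sigma> t + \<nu> t \<in> tube I \<delta>" "closest_point I (\<sigma> t + \<nu> t) = \<sigma> t" if "t \<in> K" for t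
    using disc[OF that] closest_point_tubular[OF tubular] unfolding tube_def by blast+
  ultimately show thesis
    using J'(3) smooth_on_subset[OF smooth_\<alpha>, of K] by (intro that[of K "\<lambda>t. \<sigma> t + \<nu> t"]) auto
qed

lemma A_normal_lift:
  assumes "s \<in> T" and n: "n \<in> N"
  shows "A (s + B s + n) = s"
proof -
  obtain \<sigma> J where s: "open J" "0 \<in> J" "smooth_on J \<sigma>" "\<sigma> ` J \<subseteq> I" "\<sigma> 0 = x" "evel \<sigma> = s"
    using assms(1) unfolding etangent_iff by blast
  obtain K \<alpha> where K: "open K" "0 \<in> K" "smooth_on K \<alpha>"
    "\<And>t. t \<in> K \<Longrightarrow> closest_point I (\<alpha> t) = \<sigma> t" "\<alpha> 0 = a" "evel \<alpha> = s + B s + n"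
    using normal_lift[OF s(1-5) n] s(6) by metis
  have "((\<lambda>t. closest_point I (\<alpha> t)) has_vector_derivative A (s + B s + n)) (at 0)"
    using evel_compose[OF K(3,2), of "closest_point I"] closest_point_differentiable K(5,6) by simp
  then have "(\<sigma> has_vector_derivative A (s + B s + n)) (at 0)"
    by (rule has_vector_derivative_transform_within_open[OF _ K(1,2) K(4)])
  with s(6) show ?thesis
    by (simp add: evel_eqI)
qed

lemma A_normal:
  assumes "n \<in> N"
  shows "A n = 0"
proof -
  have "linear B"
    by (rule linear_frechet_derivative[OF smooth_on_differentiable[OF smooth_grad x_in(1)]])
  then show ?thesis
    using A_normal_lift[OF subspace_0[OF subspace_T] assms] by (simp add: linear_0)
qed

lemma H_in_T: "v \<in> T \<Longrightarrow> H v \<in> T"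
  and H_tangential_part: "v \<in> T \<Longrightarrow> v + B v - H v \<in> N"
  using H_map_grad[OF x_in \<xi>_normal, of v] by (simp_all add: offset(1))

lemma A_H:
  assumes "v \<in> T"
  shows "A (H v) = v"
proof -
  have "A (v + B v + - (v + B v - H v)) = v"
    by (rule A_normal_lift[OF assms subspace_neg[OF subspace_N H_tangential_part[OF assms]]])
  then show ?thesis
    by simp
qed

lemma closest_point_line:
  obtains J where "open J" "0 \<in> J" "(\<lambda>t. a + t *\<^sub>R u) ` J \<subseteq> tube I \<delta>"
    "smooth_on J (\<lambda>t. closest_point I (a + t *\<^sub>R u))" "(\<lambda>t. closest_point I (a + t *\<^sub>R u)) ` J \<subseteq> I"
    "evel (\<lambda>t. closest_point I (a + t *\<^sub>R u)) = A u"
proof -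
  define J where "J = {t \<in> UNIV. a + t *\<^sub>R u \<in> tube I \<delta>}"
  have J: "open J" "0 \<in> J"
    unfolding J_def
    using open_preimage_of_openin[of UNIV euclidean "\<lambda>t. a + t *\<^sub>R u"] a_in_tube open_tube
      smooth_on_imp_continuous_on[OF smooth_on_affine[of UNIV a u]]
    by auto
  have "((\<lambda>t. a + t *\<^sub>R u) has_vector_derivative u) (at 0)"
    by (auto intro!: derivative_eq_intros)
  then have "evel (\<lambda>t. closest_point I (a + t *\<^sub>R u)) = A u"
    using evel_closest_point[OF smooth_on_affine[of UNIV a u]] by (simp add: evel_eqI)
  moreover have "smooth_on J (\<lambda>t. closest_point I (a + t *\<^sub>R u))"
    by (rule smooth_on_closest_point_path[OF J(1) _ smooth_on_affine]) (auto simp: J_def)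
  moreover have "closest_point I (a + t *\<^sub>R u) \<in> I" if "t \<in> J" for t
    using tube_offset_normal[OF tubular, of "a + t *\<^sub>R u"] that by (simp add: J_def normal_bundle_disc_def)
  ultimately show thesis
    using J by (intro that[of J]) (auto simp: J_def)
qed

lemma A_in_T: "A u \<in> T"
proof -
  obtain J where "open J" "0 \<in> J" "(\<lambda>t. a + t *\<^sub>R u) ` J \<subseteq> tube I \<delta>"
    "smooth_on J (\<lambda>t. closest_point I (a + t *\<^sub>R u))"
    "(\<lambda>t. closest_point I (a + t *\<^sub>R u)) ` J \<subseteq> I" "evel (\<lambda>t. closest_point I (a + t *\<^sub>R u)) = A u"
    by (rule closest_point_line[of u])
  then show ?thesis
    unfolding etangent_iff by (intro exI[of _ "\<lambda>t. closest_point I (a + t *\<^sub>R u)"] exI[of _ J]) (simp add: x_def)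
qed

text \<open>Along the line \<open>a + t u\<close> the offset from the closest point stays orthogonal to every tangent
  field. Differentiating this at time 0 shows that \<open>u\<close> and \<open>A u + B (A u)\<close> have the same tangential part.\<close>

lemma H_A: "u - H (A u) \<in> N"
proof -
  define \<sigma> where "\<sigma> t = closest_point I (a + t *\<^sub>R u)" for t
  obtain J where J: "open J" "0 \<in> J" "(\<lambda>t. a + t *\<^sub>R u) ` J \<subseteq> tube I \<delta>"
    "smooth_on J \<sigma>" "\<sigma> ` J \<subseteq> I" "evel \<sigma> = A u"
    unfolding \<sigma>_def by (rule closest_point_line[of u])
  have \<sigma>0: "\<sigma> 0 = x"
    by (simp add: \<sigma>_def x_def)
  define J' where "J' = {t \<in> J. \<sigma> t \<in> U}"
  have J': "open J'" "0 \<in> J'"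
    using open_preimage_of_openin[of J euclidean \<sigma> U] J smooth_on_imp_continuous_on[OF J(4)] open_U x_in \<sigma>0
    by (auto simp: J'_def)
  have "w \<bullet> (u - (A u + B (A u))) = 0" if w: "w \<in> T" for w
  proof -
    obtain Y where Y: "smooth_on U Y" "\<And>q. q \<in> I \<inter> U \<Longrightarrow> Y q \<in> etangent I q" "Y x = w"
      using tangent_field_exists[OF x_in w] by blast
    have DY: "frechet_derivative Y (at x) (A u) \<bullet> (a - x) = - (w \<bullet> B (A u))"
      using tangent_field_derivative_inner_grad[OF x_in \<xi>_normal A_in_T open_U x_in(1) Y(1,2)] Y(3)
      by (simp add: offset(1))
    have Y': "((\<lambda>t. Y (\<sigma> t)) has_vector_derivative frechet_derivative Y (at x) (A u)) (at 0)"
      using evel_compose[OF J(4,2), of Y] smooth_on_differentiable[OF Y(1) x_in(1)] J(6) \<sigma>0 by simp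
    have offset': "((\<lambda>t. a + t *\<^sub>R u - \<sigma> t) has_vector_derivative u - A u) (at 0)"
    proof (rule has_vector_derivative_diff)
      show "((\<lambda>t. a + t *\<^sub>R u) has_vector_derivative u) (at 0)"
        by (auto intro!: derivative_eq_intros)
      show "(\<sigma> has_vector_derivative A u) (at 0)"
        using smooth_on_has_evel[OF J(4,2)] J(6) by simp
    qed
    have "w \<bullet> (u - A u) + frechet_derivative Y (at x) (A u) \<bullet> (a - x) = 0"
    proof (rule has_vector_derivative_locally_zero[OF _ J'])
      show "((\<lambda>t. Y (\<sigma> t) \<bullet> (a + t *\<^sub>R u - \<sigma> t)) has_vector_derivative
          w \<bullet> (u - A u) + frechet_derivative Y (at x) (A u) \<bullet> (a - x)) (at 0)"
        using bounded_bilinear.has_vector_derivative[OF bounded_bilinear_inner Y' offset'] \<sigma>0 Y(3) by simp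
      show "Y (\<sigma> t) \<bullet> (a + t *\<^sub>R u - \<sigma> t) = 0" if "t \<in> J'" for t
      proof -
        have "Y (\<sigma> t) \<in> etangent I (\<sigma> t)"
          using Y(2) that J(5) by (auto simp: J'_def)
        moreover have "a + t *\<^sub>R u - \<sigma> t \<in> normal_space I (\<sigma> t)"
          using tube_offset_normal[OF tubular, of "a + t *\<^sub>R u"] J(3) that
          by (auto simp: J'_def \<sigma>_def normal_bundle_disc_def)
        ultimately show ?thesis
          by (simp add: normal_space_def orthogonal_comp_iff)
      qed
    qed
    then show ?thesis
      using DY by (simp add: inner_diff_right inner_add_right)
  qed
  then have "u - (A u + B (A u)) \<in> N"
    by (simp add: normal_space_def orthogonal_comp_iff)
  then have "(u - (A u + B (A u))) + (A u + B (A u) - H (A u)) \<in> N"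
    by (rule subspace_add[OF subspace_N _ H_tangential_part[OF A_in_T]])
  then show ?thesis
    by simp
qed

lemma H_A_tangent:
  assumes "u \<in> T"
  shows "H (A u) = u"
proof -
  have "u - H (A u) \<in> T"
    by (rule subspace_diff[OF subspace_T assms H_in_T[OF A_in_T]])
  moreover have "u - H (A u) \<in> T\<^sup>\<bottom>"
    using H_A by (simp add: normal_space_def)
  ultimately show ?thesis
    using orthogonal_comp_disjoint by fastforce
qed

lemma bij_betw_H: "bij_betw H T T"
  by (rule bij_betw_byWitness[where f' = A]) (auto simp: A_H H_A_tangent H_in_T A_in_T)

lemma inv_into_H: "u \<in> T \<Longrightarrow> inv_into T H u = A u"
  using bij_betw_H A_in_T H_A_tangent by (intro inv_into_f_eq) (auto simp: bij_betw_def)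

end

lemma tubular_point_exists:
  assumes "embedded_submanifold euclidean_mfd m I" and "tubular_radius I \<delta>" and "a \<in> tube I \<delta>"
  obtains U V \<phi> \<psi> \<xi> where "tubular_point I U V \<phi> \<psi> \<delta> a \<xi>"
proof -
  have disc: "closest_point I a \<in> I" "a - closest_point I a \<in> normal_space I (closest_point I a)"
    using tube_offset_normal[OF assms(2,3)] by (simp_all add: normal_bundle_disc_def)
  obtain U V \<phi> \<psi> where chart: "slice_chart I U V \<phi> \<psi>" "closest_point I a \<in> U"
    by (rule embedded_submanifold_slice_chart[OF assms(1) disc(1)])
  interpret slice_chart I U V \<phi> \<psi>
    by (rule chart(1))
  obtain \<xi> where "\<xi> \<in> V\<^sup>\<bottom>" "grad \<xi> (closest_point I a) = a - closest_point I a"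
    by (rule normal_is_grad[OF chart(2) disc])
  then have "tubular_point I U V \<phi> \<psi> \<delta> a \<xi>"
    using assms(2,3) chart(2) by unfold_locales
  then show thesis
    by (rule that)
qed

section \<open>The condition number of the approximation problem\<close>

context tubular_point
begin

text \<open>A curve through \<open>(a, y)\<close> is projected to a curve in \<open>S\<close>. For the converse a curve in \<open>S\<close> through
  \<open>(x, y)\<close> stays in the relatively open set \<open>W\<close> for a short time and is lifted by \<open>normal_lift\<close>. The
  lift can be given the velocity \<open>v\<close>, since \<open>v\<close> and \<open>A v + B (A v)\<close> have the same tangential part
  \<open>H (A v)\<close> and thus differ by a normal vector.\<close>

lemma ptangent_S_AP_iff:
  fixes M :: "('b, 'e::real_normed_vector) manifold"
  assumes M: "smooth_manifold M" and S: "S \<subseteq> I \<times> topspace (mtop M)"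
    and W: "openin (subtopology (mtop (prod_mfd euclidean_mfd M)) S) W" and xy: "(x, y) \<in> W"
  shows "(v, w) \<in> ptangent M (S_AP I \<delta> M W) (a, y) \<longleftrightarrow> (A v, w) \<in> ptangent M S (x, y)"
proof
  assume "(v, w) \<in> ptangent M (S_AP I \<delta> M W) (a, y)"
  then obtain J \<alpha> \<beta> where J: "open J" "0 \<in> J" "smooth_on J \<alpha>" "smooth_path J M \<beta>"
    "\<forall>t\<in>J. (\<alpha> t, \<beta> t) \<in> S_AP I \<delta> M W" "\<alpha> 0 = a" "\<beta> 0 = y" "evel \<alpha> = v" "vel M \<beta> = w"
    unfolding ptangent_iff[OF M] by blast
  have "smooth_on J (\<lambda>t. closest_point I (\<alpha> t))"
    using J(5) by (intro smooth_on_closest_point_path J) (auto simp: S_AP_def)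
  moreover have "evel (\<lambda>t. closest_point I (\<alpha> t)) = A v"
    using evel_closest_point[OF J(3,2,6)] J(8) by simp
  moreover have "\<forall>t\<in>J. (closest_point I (\<alpha> t), \<beta> t) \<in> S"
    using J(5) openin_subset[OF W] by (auto simp: S_AP_def)
  ultimately show "(A v, w) \<in> ptangent M S (x, y)"
    unfolding ptangent_iff[OF M] using J
    by (intro exI[of _ J] exI[of _ "\<lambda>t. closest_point I (\<alpha> t)"] exI[of _ \<beta>]) (simp add: x_def)
next
  assume "(A v, w) \<in> ptangent M S (x, y)"
  then obtain J \<sigma> \<beta> where J: "open J" "0 \<in> J" "smooth_on J \<sigma>" "smooth_path J M \<beta>"
    "\<forall>t\<in>J. (\<sigma> t, \<beta> t) \<in> S" "\<sigma> 0 = x" "\<beta> 0 = y" "evel \<sigma> = A v" "vel M \<beta> = w"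
    unfolding ptangent_iff[OF M] by blast
  obtain G where G: "openin (mtop (prod_mfd euclidean_mfd M)) G" "W = G \<inter> S"
    using W unfolding openin_subtopology by blast
  define J' where "J' = {t \<in> J. (\<sigma> t, \<beta> t) \<in> G}"
  have "smooth_path J (prod_mfd euclidean_mfd M) (\<lambda>t. (\<sigma> t, \<beta> t))"
    using J(3,4) by (simp add: smooth_path_prod_iff[OF M J(1)] o_def)
  then have "open J'"
    unfolding J'_def smooth_path_def using open_preimage_of_openin[OF J(1) _ G(1)] by blast
  have "0 \<in> J'" "J' \<subseteq> J"
    using J xy G(2) by (auto simp: J'_def)
  have "\<sigma> ` J' \<subseteq> I"
    using J(5) S \<open>J' \<subseteq> J\<close> by blast
  have "(A v + B (A v) - H (A v)) - (v - H (A v)) \<in> N"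
    by (rule subspace_diff[OF subspace_N H_tangential_part[OF A_in_T] H_A])
  then have n: "v - (A v + B (A v)) \<in> N"
    using subspace_neg[OF subspace_N] by fastforce
  obtain K \<alpha> where K: "open K" "0 \<in> K" "K \<subseteq> J'" "smooth_on K \<alpha>" "\<alpha> ` K \<subseteq> tube I \<delta>"
    "\<And>t. t \<in> K \<Longrightarrow> closest_point I (\<alpha> t) = \<sigma> t" "\<alpha> 0 = a" "evel \<alpha> = v"
    using normal_lift[OF \<open>open J'\<close> \<open>0 \<in> J'\<close> smooth_on_subset[OF J(3) \<open>J' \<subseteq> J\<close>] \<open>\<sigma> ` J' \<subseteq> I\<close> J(6) n]
    unfolding J(8) by (metis add_diff_cancel_left' add_diff_eq)
  have "(\<alpha> t, \<beta> t) \<in> S_AP I \<delta> M W" if "t \<in> K" for t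
  proof -
    have "t \<in> J" "(\<sigma> t, \<beta> t) \<in> G"
      using that K(3) by (auto simp: J'_def)
    moreover have "(\<sigma> t, \<beta> t) \<in> S"
      using J(5) \<open>t \<in> J\<close> by blast
    moreover have "\<alpha> t \<in> tube I \<delta>"
      using K(5) that by blast
    ultimately show ?thesis
      using S G(2) K(6)[OF that] by (auto simp: S_AP_def)
  qed
  then show "(v, w) \<in> ptangent M (S_AP I \<delta> M W) (a, y)"
    unfolding ptangent_iff[OF M] using K J smooth_path_subset[OF J(4), of K] \<open>J' \<subseteq> J\<close>
    by (intro exI[of _ K] exI[of _ \<alpha>] exI[of _ \<beta>]) auto
qed

end

lemma spectral_norm_cong:
  "(\<And>t. t \<in> V \<Longrightarrow> A t = B t) \<Longrightarrow> spectral_norm g y V A = spectral_norm g y V B"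
  unfolding spectral_norm_def by (rule SUP_cong) auto

text \<open>Dropping the normal component of an argument keeps the value of \<open>F\<close> and does not increase the
  norm in the denominator. An argument without tangential component contributes 0, which does not
  affect a supremum in the extended nonnegative reals, even over the empty set.\<close>

lemma spectral_norm_UNIV_eq_subspace:
  fixes T :: "'a::euclidean_space set"
  assumes T: "subspace T" and F: "\<And>t n. t \<in> T \<Longrightarrow> n \<in> T\<^sup>\<bottom> \<Longrightarrow> F (t + n) = F t"
    and zero: "g y (F 0) (F 0) = 0"
  shows "spectral_norm g y UNIV F = spectral_norm g y T F"
proof (rule antisym)
  show "spectral_norm g y UNIV F \<le> spectral_norm g y T F"
    unfolding spectral_norm_def
  proof (rule SUP_least)
    fix z :: 'a
    assume "z \<in> UNIV - {0}"
    obtain t n where tn: "t \<in> T" "n \<in> T\<^sup>\<bottom>" "z = t + n"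
      by (rule orthogonal_decomposition[OF T])
    have "orthogonal t n"
      using tn by (simp add: orthogonal_comp_iff orthogonal_def)
    then have "(norm z)\<^sup>2 = (norm t)\<^sup>2 + (norm n)\<^sup>2"
      unfolding tn(3) by (rule norm_add_Pythagorean)
    then have "(norm t)\<^sup>2 \<le> (norm z)\<^sup>2"
      by simp
    then have le: "norm t \<le> norm z"
      by (rule power2_le_imp_le) simp
    have Fz: "F z = F t"
      unfolding tn(3) by (rule F[OF tn(1,2)])
    show "ennreal (sqrt (g y (F z) (F z)) / norm z)
        \<le> (SUP t\<in>T - {0}. ennreal (sqrt (g y (F t) (F t)) / norm t))"
    proof (cases "sqrt (g y (F t) (F t)) \<le> 0 \<or> t = 0")
      case True
      then have "sqrt (g y (F z) (F z)) / norm z \<le> 0"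
        using zero Fz by (auto simp: divide_nonpos_nonneg)
      then show ?thesis
        by (simp add: ennreal_neg)
    next
      case False
      then have "sqrt (g y (F z) (F z)) / norm z \<le> sqrt (g y (F t) (F t)) / norm t"
        using le \<open>z \<in> UNIV - {0}\<close> unfolding Fz by (intro divide_left_mono mult_pos_pos) auto
      then have "ennreal (sqrt (g y (F z) (F z)) / norm z) \<le> ennreal (sqrt (g y (F t) (F t)) / norm t)"
        by (rule ennreal_leI)
      also have "\<dots> \<le> (SUP t\<in>T - {0}. ennreal (sqrt (g y (F t) (F t)) / norm t))"
        using tn(1) False by (intro SUP_upper) simp
      finally show ?thesis .
    qed
  qed
  show "spectral_norm g y T F \<le> spectral_norm g y UNIV F"
    unfolding spectral_norm_def by (rule SUP_subset_mono) auto
qed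

theorem theorem5p2:
  fixes \<I> :: "(real ^ 'n) set"
    and \<O> :: "('b, 'e::real_normed_vector) manifold"
    and g :: "'b \<Rightarrow> ('b, 'e) tangent \<Rightarrow> ('b, 'e) tangent \<Rightarrow> real"
    and \<S> :: "((real ^ 'n) \<times> 'b) set"
    and \<delta> :: "real ^ 'n \<Rightarrow> real"
    and m :: nat
    and a x \<eta> :: "real ^ 'n"
    and y :: 'b
  assumes I: "embedded_submanifold euclidean_mfd m \<I>"
    and Ob: "smooth_manifold \<O>" "riemannian_metric \<O> g"
    and S: "\<S> \<subseteq> \<I> \<times> topspace (mtop \<O>)"
      "embedded_submanifold (prod_mfd euclidean_mfd \<O>) m \<S>"
    and surj: "fst ` \<S> = \<I>"
    and W_open: "openin (subtopology (mtop (prod_mfd euclidean_mfd \<O>)) \<S>) (well_posed \<I> \<O> \<S>)"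
    and W_dense: "\<S> \<subseteq> mtop (prod_mfd euclidean_mfd \<O>) closure_of (well_posed \<I> \<O> \<S>)"
    and T: "tubular_radius \<I> \<delta>"
    and a: "a \<in> tube \<I> \<delta>"
    and x: "x = closest_point \<I> a"
    and y: "(a, y) \<in> S_AP \<I> \<delta> \<O> \<S>"
    and eta: "\<eta> = a - x"
  shows "kappa_AP \<I> \<delta> \<O> g \<S> (a, y) =
      (if bij_betw (D1 \<O> \<S> (x, y)) (ptangent \<O> \<S> (x, y)) (etangent \<I> x) \<and>
          bij_betw (H_map \<I> x \<eta>) (etangent \<I> x) (etangent \<I> x)
       then spectral_norm g y (etangent \<I> x)
         (D2 \<O> \<S> (x, y) \<circ> inv_into (ptangent \<O> \<S> (x, y)) (D1 \<O> \<S> (x, y))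
            \<circ> inv_into (etangent \<I> x) (H_map \<I> x \<eta>))
       else \<infinity>)
    \<and> ((a, y) \<in> S_AP \<I> \<delta> \<O> \<S> - W_AP \<I> \<delta> \<O> \<S> \<longrightarrow>
        \<not> bij_betw (D1 \<O> \<S> (x, y)) (ptangent \<O> \<S> (x, y)) (etangent \<I> x))"
proof (intro conjI impI)
  let ?T = "etangent \<I> x" and ?TS = "ptangent \<O> \<S> (x, y)" and ?D = "D1 \<O> \<S> (x, y)"
  let ?W = "W_AP \<I> \<delta> \<O> \<S>"
  have xy: "(x, y) \<in> \<S>" and y_top: "y \<in> topspace (mtop \<O>)"
    using y by (simp_all add: S_AP_def x)
  have W_iff: "(a, y) \<in> ?W \<longleftrightarrow> bij_betw ?D ?TS ?T"
    using y xy by (simp add: W_AP_def S_AP_def well_posed_def x)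
  show "\<not> bij_betw ?D ?TS ?T" if "(a, y) \<in> S_AP \<I> \<delta> \<O> \<S> - ?W"
    using that W_iff by blast
  show "kappa_AP \<I> \<delta> \<O> g \<S> (a, y) =
      (if bij_betw ?D ?TS ?T \<and> bij_betw (H_map \<I> x \<eta>) ?T ?T
       then spectral_norm g y ?T (D2 \<O> \<S> (x, y) \<circ> inv_into ?TS ?D \<circ> inv_into ?T (H_map \<I> x \<eta>))
       else \<infinity>)"
  proof (cases "bij_betw ?D ?TS ?T")
    case False
    then show ?thesis
      using W_iff by (auto simp: kappa_AP_def Let_def)
  next
    case True
    let ?T' = "ptangent \<O> ?W (a, y)" and ?D' = "D1 \<O> ?W (a, y)"
    obtain U V \<phi> \<psi> \<xi> where "tubular_point \<I> U V \<phi> \<psi> \<delta> a \<xi>"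
      by (rule tubular_point_exists[OF I T a])
    then interpret t: tubular_point \<I> U V \<phi> \<psi> \<delta> a \<xi> .
    have tx: "t.x = x"
      by (simp add: t.x_def x)
    have "(x, y) \<in> well_posed \<I> \<O> \<S>"
      using True xy by (simp add: well_posed_def)
    then have tangent_W: "(v, w) \<in> ?T' \<longleftrightarrow> (t.A v, w) \<in> ?TS" for v w
      using t.ptangent_S_AP_iff[OF Ob(1) S(1) W_open] by (simp add: tx W_AP_def)
    \<comment> \<open>The tangent space of \<open>\<S>\<close> at \<open>(x, y)\<close> is the graph of \<open>L\<close> over the tangent space of \<open>\<I>\<close>.\<close>
    define L where "L u = snd (inv_into ?TS ?D u)" for u
    have L: "(u, L u) \<in> ?TS" if "u \<in> ?T" for u
    proof -
      have "inv_into ?TS ?D u \<in> ?TS" "?D (inv_into ?TS ?D u) = u"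
        using bij_betwE[OF bij_betw_inv_into[OF True]] bij_betw_inv_into_right[OF True] that by blast+
      then show ?thesis
        unfolding L_def by (metis D1_eq_fst prod.collapse)
    qed
    have L_unique: "w = L u" if "(u, w) \<in> ?TS" for u w
    proof -
      have "u \<in> ?T"
        by (rule fst_ptangent_in_etangent[OF Ob(1) S(1) that])
      then have "?D (u, w) = ?D (u, L u)"
        using that L by (simp add: D1_eq_fst)
      then show ?thesis
        using bij_betw_imp_inj_on[OF True] that L[OF \<open>u \<in> ?T\<close>] by (auto dest: inj_onD)
    qed
    have A_in: "t.A v \<in> ?T" for v
      using t.A_in_T by (simp add: tx)
    have graph: "(v, w) \<in> ?T' \<longleftrightarrow> w = L (t.A v)" for v w
      using tangent_W L[OF A_in] L_unique by blast
    have bij: "bij_betw ?D' ?T' UNIV"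
      by (rule bij_betw_byWitness[where f' = "\<lambda>v. (v, L (t.A v))"]) (auto simp: D1_eq_fst graph)
    have inv: "inv_into ?T' ?D' v = (v, L (t.A v))" for v
      using bij by (intro inv_into_f_eq) (auto simp: bij_betw_def D1_eq_fst graph)
    have "kappa_AP \<I> \<delta> \<O> g \<S> (a, y) = spectral_norm g y UNIV (D2 \<O> ?W (a, y) \<circ> inv_into ?T' ?D')"
      using W_iff True bij by (simp add: kappa_AP_def Let_def)
    also have "\<dots> = spectral_norm g y UNIV (\<lambda>v. L (t.A v))"
      by (rule spectral_norm_cong) (simp add: inv D2_eq_snd graph)
    also have "\<dots> = spectral_norm g y ?T (\<lambda>v. L (t.A v))"
    proof (rule spectral_norm_UNIV_eq_subspace)
      show "subspace ?T"
        using t.subspace_T by (simp add: tx)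
      show "L (t.A (u + n)) = L (t.A u)" if "n \<in> ?T\<^sup>\<bottom>" for u n
        using t.A_normal[of n] that by (simp add: linear_add[OF t.linear_A] normal_space_def tx)
      have "L (t.A 0) = (\<lambda>c. 0)"
        using L_unique[OF zero_in_ptangent[OF Ob(1) xy y_top]] by (simp add: linear_0[OF t.linear_A])
      then show "g y (L (t.A 0)) (L (t.A 0)) = 0"
        using riemannian_metric_zero[OF Ob y_top] by simp
    qed
    also have "\<dots> = spectral_norm g y ?T (D2 \<O> \<S> (x, y) \<circ> inv_into ?TS ?D \<circ> inv_into ?T (H_map \<I> x \<eta>))"
    proof (rule spectral_norm_cong)
      fix u
      assume "u \<in> ?T"
      then have "inv_into ?T (H_map \<I> x \<eta>) u = t.A u"
        using t.inv_into_H[of u] by (simp add: tx eta)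
      moreover have "inv_into ?TS ?D (t.A u) \<in> ?TS"
        using bij_betwE[OF bij_betw_inv_into[OF True]] A_in by blast
      ultimately show "L (t.A u)
          = (D2 \<O> \<S> (x, y) \<circ> inv_into ?TS ?D \<circ> inv_into ?T (H_map \<I> x \<eta>)) u"
        by (simp add: L_def D2_eq_snd)
    qed
    finally show ?thesis
      using True t.bij_betw_H by (simp add: tx eta)
  qed
qed

end
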